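(* Let $q$ be a prime power and $m,\delta$ integers with $m\ge2$ and $2\le\delta\le\delta_{\max}=q^{\lceil m/2\rceil}-1-(q-2)[m\text{ odd}]$. Then there exists a $q$-ary quantum stabilizer code $Q$ with parameters $$[[\,q^m-1,\ q^m-1-2m\lceil(\delta-1)(1-1/q)\rceil,\ d_Q\ge\delta\,]]_q$$ that is pure up to $\delta_{\max}+1$. Moreover, if $\mathcal{BCH}(q^m-1,q;\delta)$ has true minimum distance $d$ with $d\le\delta_{\max}$, then $Q$ is a pure quantum code with minimum distance $d_Q=d$.
   Context: $\mathcal{BCH}(n,q;\delta)$ with $n=q^m-1$ denotes the primitive, narrow-sense BCH code: with $\alpha$ a primitive element of $\mathbf{F}_{q^m}$ and $C_x=\{xq^k\bmod n\mid k\in\mathbf{Z}\}$, it is the cyclic code of length $n$ over $\mathbf{F}_q$ with generator polynomial $\prod_{z\in Z}(x-\alpha^z)$, $Z=C_1\cup\cdots\cup C_{\delta-1}$. An $[[n,k,d]]_q$ quantum stabilizer code is a $q^k$-dimensional subspace of $(\mathbf{C}^q)^{\otimes n}$ that is the joint fixed space of an abelian subgroup $S$ (the stabilizer) of the $q$-ary Pauli error group on $n$ qudits, with minimum distance $d$ (the smallest weight of an error in the normalizer of $S$ but not in $S$, up to scalars). It is pure up to $t$ if $S$ contains no non-scalar element of weight less than $t$; it is pure if it is pure up to its minimum distance. Iverson notation: $[P]=1$ if $P$ holds, $0$ otherwise. *)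

theory Defs
  imports Complex_Main "HOL-Computational_Algebra.Polynomial" "HOL-Library.Cardinality"
begin

definition vecs :: "nat \<Rightarrow> (nat \<Rightarrow> 'a::zero) set" where
  "vecs n = {x. \<forall>i\<ge>n. x i = 0}"

definition dotp :: "nat \<Rightarrow> (nat \<Rightarrow> 'a::comm_ring_1) \<Rightarrow> (nat \<Rightarrow> 'a) \<Rightarrow> 'a" where
  "dotp n x y = (\<Sum>i<n. x i * y i)"

definition hweight :: "nat \<Rightarrow> (nat \<Rightarrow> 'a::zero) \<Rightarrow> nat" where
  "hweight n x = card {i. i < n \<and> x i \<noteq> 0}"

definition fdeg :: "'a::{finite,field} itself \<Rightarrow> nat" where
  "fdeg T = (LEAST r. 0 < r \<and> CHAR('a) ^ r = CARD('a))"

definition ftrace :: "'a::{finite,field} \<Rightarrow> 'a" where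
  "ftrace y = (\<Sum>i<fdeg TYPE('a). y ^ (CHAR('a) ^ i))"

definition omega :: "'a::{finite,field} itself \<Rightarrow> complex" where
  "omega T = cis (2 * pi / real CHAR('a))"

definition fchar :: "'a::{finite,field} \<Rightarrow> complex" where
  "fchar y = omega TYPE('a) ^ (THE j. j < CHAR('a) \<and> of_nat j = ftrace y)"

text \<open>State space (C^q)^{\<otimes>n}: complex functions on the computational basis
  {|x>, x in F_q^n}; vectors are functions (nat => 'a) => complex supported on vecs n.\<close>
definition hspace :: "nat \<Rightarrow> ((nat \<Rightarrow> 'a::zero) \<Rightarrow> complex) set" where
  "hspace n = {f. \<forall>x. x \<notin> vecs n \<longrightarrow> f x = 0}"

text \<open>The operator omega^c X(a) Z(b), where X(a)|x> = |x+a>, Z(b)|x> = omega^{tr(b.x)}|x>.\<close>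
definition pauli :: "nat \<Rightarrow> nat \<Rightarrow> (nat \<Rightarrow> 'a::{finite,field}) \<Rightarrow> (nat \<Rightarrow> 'a)
    \<Rightarrow> ((nat \<Rightarrow> 'a) \<Rightarrow> complex) \<Rightarrow> ((nat \<Rightarrow> 'a) \<Rightarrow> complex)" where
  "pauli n c a b f = (\<lambda>y. omega TYPE('a) ^ c * fchar (dotp n b (\<lambda>i. y i - a i)) * f (\<lambda>i. y i - a i))"

type_synonym 'a qop = "((nat \<Rightarrow> 'a) \<Rightarrow> complex) \<Rightarrow> ((nat \<Rightarrow> 'a) \<Rightarrow> complex)"

definition pauli_group :: "nat \<Rightarrow> 'a::{finite,field} qop set" where
  "pauli_group n = {pauli n c a b | c a b. a \<in> vecs n \<and> b \<in> vecs n}"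

definition pweight :: "nat \<Rightarrow> 'a::{finite,field} qop \<Rightarrow> nat" where
  "pweight n E = (LEAST w. \<exists>c a b. a \<in> vecs n \<and> b \<in> vecs n \<and> E = pauli n c a b
                       \<and> w = card {i. i < n \<and> (a i \<noteq> 0 \<or> b i \<noteq> 0)})"

definition scalar_op :: "nat \<Rightarrow> 'a::{finite,field} qop \<Rightarrow> bool" where
  "scalar_op n E = (\<exists>c. E = pauli n c (\<lambda>_. 0) (\<lambda>_. 0))"

definition abelian_pauli_subgroup :: "nat \<Rightarrow> 'a::{finite,field} qop set \<Rightarrow> bool" where
  "abelian_pauli_subgroup n S =
     (S \<subseteq> pauli_group n \<and> id \<in> S \<and> (\<forall>E\<in>S. \<forall>F\<in>S. E \<circ> F \<in> S)
      \<and> (\<forall>E\<in>S. \<exists>F\<in>S. F \<circ> E = id) \<and> (\<forall>E\<in>S. \<forall>F\<in>S. E \<circ> F = F \<circ> E))"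

definition fixed_space :: "nat \<Rightarrow> 'a::{finite,field} qop set \<Rightarrow> ((nat \<Rightarrow> 'a) \<Rightarrow> complex) set" where
  "fixed_space n S = {v \<in> hspace n. \<forall>E\<in>S. E v = v}"

definition normalizer :: "nat \<Rightarrow> 'a::{finite,field} qop set \<Rightarrow> 'a qop set" where
  "normalizer n S = {E \<in> pauli_group n. \<forall>F\<in>S. \<exists>F'\<in>S. E \<circ> F = F' \<circ> E}"

definition undetectable :: "nat \<Rightarrow> 'a::{finite,field} qop set \<Rightarrow> 'a qop set" where
  "undetectable n S = {E \<in> normalizer n S. \<not> (\<exists>c. pauli n c (\<lambda>_. 0) (\<lambda>_. 0) \<circ> E \<in> S)}"

definition qdist_ge :: "nat \<Rightarrow> 'a::{finite,field} qop set \<Rightarrow> nat \<Rightarrow> bool" where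
  "qdist_ge n S d = (\<forall>E\<in>undetectable n S. d \<le> pweight n E)"

definition qmin_dist :: "nat \<Rightarrow> 'a::{finite,field} qop set \<Rightarrow> nat \<Rightarrow> bool" where
  "qmin_dist n S d = (qdist_ge n S d \<and> (\<exists>E\<in>undetectable n S. pweight n E = d))"

definition pure_upto :: "nat \<Rightarrow> 'a::{finite,field} qop set \<Rightarrow> nat \<Rightarrow> bool" where
  "pure_upto n S t = (\<forall>E\<in>S. pweight n E < t \<longrightarrow> scalar_op n E)"

definition cspan :: "(nat \<Rightarrow> ('x \<Rightarrow> complex)) \<Rightarrow> nat \<Rightarrow> ('x \<Rightarrow> complex) set" where
  "cspan vs k = {(\<lambda>x. \<Sum>j<k. c j * vs j x) | c. True}"

definition cdim :: "('x \<Rightarrow> complex) set \<Rightarrow> nat" where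
  "cdim V = (LEAST k. \<exists>vs. V = cspan vs k)"

definition cyc_coset :: "nat \<Rightarrow> nat \<Rightarrow> nat \<Rightarrow> nat set" where
  "cyc_coset q n x = {x * q ^ k mod n | k. True}"

definition bch_zeros :: "nat \<Rightarrow> nat \<Rightarrow> nat \<Rightarrow> nat set" where
  "bch_zeros q n \<delta> = (\<Union>x\<in>{1..<\<delta>}. cyc_coset q n x)"

text \<open>phi embeds F_q into F_{q^m}; alpha is a primitive element of F_{q^m}.\<close>
definition bch_gen :: "nat \<Rightarrow> nat \<Rightarrow> 'b::field \<Rightarrow> nat \<Rightarrow> 'b poly" where
  "bch_gen q n \<alpha> \<delta> = (\<Prod>z\<in>bch_zeros q n \<delta>. [:- (\<alpha> ^ z), 1:])"

definition bch_code :: "nat \<Rightarrow> nat \<Rightarrow> ('a \<Rightarrow> 'b::field) \<Rightarrow> 'b \<Rightarrow> nat \<Rightarrow> (nat \<Rightarrow> 'a::zero) set" where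
  "bch_code q n \<phi> \<alpha> \<delta> = {c \<in> vecs n. bch_gen q n \<alpha> \<delta> dvd (\<Sum>i<n. monom (\<phi> (c i)) i)}"

definition classical_min_dist :: "nat \<Rightarrow> (nat \<Rightarrow> 'a::zero) set \<Rightarrow> nat \<Rightarrow> bool" where
  "classical_min_dist n C d = ((\<exists>c\<in>C. c \<noteq> (\<lambda>_. 0) \<and> hweight n c = d) \<and> (\<forall>c\<in>C. c \<noteq> (\<lambda>_. 0) \<longrightarrow> d \<le> hweight n c))"

end

theory Submission
  imports Defs "HOL-Library.FuncSet" "HOL-Library.Function_Algebras" "HOL-Library.Disjoint_Sets"
begin

text \<open>
  Let \<open>R\<close> be the set of \<open>z < \<delta>\<close> not divisible by \<open>q\<close>, and let \<open>D\<close> be the trace code of all words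
  \<open>i \<mapsto> Tr (\<Sum>z\<in>R. l z * \<alpha> ^ (z * i))\<close>. Since \<open>c \<bullet> Tr (l \<alpha>\<^sup>z\<^sup>i) = Tr (l c(\<alpha>\<^sup>z))\<close>, nondegeneracy of the trace
  shows that the BCH code is the dual of \<open>D\<close> (Delsarte). By orthogonality of the powers of \<open>\<alpha>\<close>, the
  spectrum of a word of \<open>D\<close> lives on the negatives of the cyclotomic cosets of \<open>R\<close>. As
  \<open>(\<delta>\<^sub>m\<^sub>a\<^sub>x - 1) (q ^ (m div 2) + 1) < q ^ m - 1\<close>, these cosets are distinct, of size \<open>m\<close>, and their negatives
  avoid \<open>0, \<dots>, \<delta>\<^sub>m\<^sub>a\<^sub>x - 1\<close>. Hence \<open>D\<close> has \<open>q ^ (m |R|)\<close> words, is self-orthogonal, and the BCH bound gives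
  its nonzero words weight at least \<open>\<delta>\<^sub>m\<^sub>a\<^sub>x + 1\<close>. The quantum code is the CSS code whose stabilizer consists of
  \<open>X(a) Z(b)\<close> with \<open>a, b \<in> D\<close>: its fixed space is the space of functions on the dual of \<open>D\<close> that are
  constant on the cosets of \<open>D\<close>, and its normalizer consists of the \<open>X(a) Z(b)\<close> with \<open>a, b\<close> in the BCH code.
\<close>

section \<open>Finite fields and power traces\<close>

lemma prime_CHAR_finite: "prime CHAR('a::{finite,field})"
  by (rule prime_CHAR_semidom) (rule finite_imp_CHAR_pos, simp)

text \<open>Multiplication by a nonzero \<open>x\<close> permutes the nonzero elements, so their
  product is unchanged when every factor is multiplied by \<open>x\<close>.\<close>

lemma power_CARD_eq_self:
  fixes x :: "'a::{finite,field}"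
  shows "x ^ CARD('a) = x"
proof (cases "x = 0")
  case False
  have "x * (\<Prod>y\<in>UNIV-{0}. x * y) = x * x ^ (CARD('a) - 1) * \<Prod>(UNIV-{0})"
    by (simp add: prod.distrib mult_ac)
  also have "x * x ^ (CARD('a) - 1) = x ^ CARD('a)"
    by (metis Suc_pred' power_Suc zero_less_card_finite)
  also have "(\<Prod>y\<in>UNIV-{0}. x * y) = (\<Prod>y\<in>UNIV-{0}. y)"
    by (rule prod.reindex_bij_witness[of _ "\<lambda>y. y / x" "\<lambda>y. x * y"]) (use False in auto)
  finally show ?thesis
    by simp
qed auto

text \<open>A count that needs no basis over the prime field: \<open>f\<close> sends a vector of
  coefficients below the characteristic, indexed by all field elements, to the corresponding linear
  combination. All fibres of \<open>f\<close> have equal size, so the number of field elements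
  divides the number of vectors.\<close>

lemma CARD_dvd_CHAR_power: "CARD('a::{finite,field}) dvd CHAR('a) ^ CARD('a)"
proof -
  let ?p = "CHAR('a)"
  let ?A = "PiE (UNIV :: 'a set) (\<lambda>_. {..<?p})"
  define f where "f c = (\<Sum>x\<in>UNIV. of_nat (c x) * x)" for c :: "'a \<Rightarrow> nat"
  have p0: "?p > 0" using prime_CHAR_finite[where 'a='a] prime_gt_0_nat by blast
  have of_nat_mod: "of_nat (k mod ?p) = (of_nat k :: 'a)" for k
  proof -
    have "(of_nat k :: 'a) = of_nat (k mod ?p + ?p * (k div ?p))" by (simp only: mod_mult_div_eq)
    then show ?thesis by (simp only: of_nat_add of_nat_mult of_nat_CHAR) simp
  qed
  have f_upd: "f (c(y := k mod ?p)) = f c + (of_nat k - of_nat (c y)) * y" for c y k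
  proof -
    have "f (c(y := k mod ?p)) = of_nat k * y + (\<Sum>x\<in>UNIV-{y}. of_nat (c x) * x)"
      unfolding f_def by (subst sum.remove[of _ y]) (auto simp: of_nat_mod)
    moreover have "f c = of_nat (c y) * y + (\<Sum>x\<in>UNIV-{y}. of_nat (c x) * x)"
      unfolding f_def by (subst sum.remove[of _ y]) auto
    ultimately show ?thesis by (simp add: algebra_simps)
  qed
  \<comment> \<open>Raising the coefficient of \<open>y\<close> by one modulo \<open>?p\<close> (the
    map \<open>?h\<close>) adds \<open>y\<close> to the value of \<open>f\<close>; adding
    \<open>?p - 1\<close> (the map \<open>?g\<close>) undoes it.\<close>
  have fib: "card {c\<in>?A. f c = y} = card {c\<in>?A. f c = 0}" for y
  proof (rule bij_betw_same_card[OF bij_betw_byWitness])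
    let ?g = "\<lambda>c. c(y := (c y + (?p - 1)) mod ?p)"
    let ?h = "\<lambda>c. c(y := (c y + 1) mod ?p)"
    have minus1: "of_nat (?p - 1) = (- 1 :: 'a)"
      using p0 by (simp add: of_nat_diff)
    have gh: "((k + (?p - 1)) mod ?p + 1) mod ?p = k" "((k + 1) mod ?p + (?p - 1)) mod ?p = k"
      if "k < ?p" for k
    proof -
      have "(k + (?p - 1)) + 1 = k + ?p" "(k + 1) + (?p - 1) = k + ?p" using p0 by auto
      then show "((k + (?p - 1)) mod ?p + 1) mod ?p = k" "((k + 1) mod ?p + (?p - 1)) mod ?p = k"
        unfolding mod_add_left_eq using that by simp_all
    qed
    show "\<forall>c\<in>{c \<in> ?A. f c = y}. ?h (?g c) = c" "\<forall>c\<in>{c \<in> ?A. f c = 0}. ?g (?h c) = c"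
      by (auto simp only: fun_upd_same fun_upd_upd gh PiE_UNIV_domain Pi_iff ball_UNIV lessThan_iff fun_upd_triv mem_Collect_eq)
    show "?g ` {c \<in> ?A. f c = y} \<subseteq> {c \<in> ?A. f c = 0}"
      using p0 minus1 by (auto simp: PiE_def Pi_def f_upd algebra_simps)
    show "?h ` {c \<in> ?A. f c = 0} \<subseteq> {c \<in> ?A. f c = y}"
      using p0 by (auto simp: PiE_def Pi_def f_upd algebra_simps)
  qed
  have finA: "finite ?A" by (intro finite_PiE) auto
  have "card ?A = (\<Sum>y\<in>UNIV. card {c\<in>?A. f c = y})"
    using sum.group[OF finA finite[of UNIV], of f "\<lambda>_. 1::nat"] by simp
  also have "\<dots> = (\<Sum>y\<in>(UNIV :: 'a set). card {c\<in>?A. f c = 0})"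
    by (intro sum.cong refl fib)
  also have "\<dots> = CARD('a) * card {c\<in>?A. f c = 0}"
    by simp
  finally have "card ?A = CARD('a) * card {c\<in>?A. f c = 0}" .
  moreover have "card ?A = ?p ^ CARD('a)" by (simp add: card_PiE)
  ultimately show ?thesis by (metis dvd_triv_left)
qed

lemma CARD_prime_power: "\<exists>r>0. CARD('a::{finite,field}) = CHAR('a) ^ r"
proof -
  obtain r where r: "CARD('a) = CHAR('a) ^ r"
    using CARD_dvd_CHAR_power prime_CHAR_finite divides_primepow_nat by metis
  have "{0, 1 :: 'a} \<subseteq> UNIV" by simp
  then have "card {0, 1 :: 'a} \<le> CARD('a)" by (intro card_mono) auto
  then have "r \<noteq> 0" using r by (auto intro: ccontr)
  then show ?thesis using r by blast
qed

text \<open>In a field with \<open>Q ^ r\<close> elements this is the trace onto the fixed field of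
  \<open>x ^ Q\<close>. It serves both the absolute trace \<open>ftrace\<close> and the relative
  trace from F_{q^m} to F_q.\<close>

definition pow_trace :: "nat \<Rightarrow> nat \<Rightarrow> 'a::comm_semiring_1 \<Rightarrow> 'a" where
  "pow_trace Q r x = (\<Sum>i<r. x ^ (Q ^ i))"

lemma power_fixed_iterate:
  fixes c :: "'a::comm_monoid_mult"
  assumes "c ^ Q = c" shows "c ^ (Q ^ i) = c"
proof (induction i)
  case (Suc i)
  then show ?case by (metis assms power_Suc2 power_mult)
qed simp

lemma char_power_add:
  fixes x y :: "'a::{finite,field}"
  assumes "Q = CHAR('a) ^ s"
  shows "(x + y) ^ (Q ^ i) = x ^ (Q ^ i) + y ^ (Q ^ i)"
  by (rule freshmans_dream'[OF prime_CHAR_finite, of _ "s * i"]) (simp add: assms power_mult)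

lemma char_power_sum:
  fixes f :: "'c \<Rightarrow> 'a::{finite,field}"
  assumes "Q = CHAR('a) ^ s"
  shows "(\<Sum>x\<in>A. f x) ^ (Q ^ i) = (\<Sum>x\<in>A. f x ^ (Q ^ i))"
  by (rule freshmans_dream_sum'[OF prime_CHAR_finite, of _ "s * i"]) (simp add: assms power_mult)

lemma pow_trace_add:
  fixes x y :: "'a::{finite,field}"
  assumes "Q = CHAR('a) ^ s"
  shows "pow_trace Q r (x + y) = pow_trace Q r x + pow_trace Q r y"
  unfolding pow_trace_def by (simp add: char_power_add[OF assms] sum.distrib)

lemma pow_trace_0: "Q > 0 \<Longrightarrow> pow_trace Q r 0 = 0"
  by (simp add: pow_trace_def power_0_left)

lemma pow_trace_sum:
  fixes f :: "'c \<Rightarrow> 'a::{finite,field}"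
  assumes "Q = CHAR('a) ^ s"
  shows "pow_trace Q r (\<Sum>x\<in>A. f x) = (\<Sum>x\<in>A. pow_trace Q r (f x))"
  unfolding pow_trace_def by (simp add: char_power_sum[OF assms] sum.swap[of _ A])

lemma pow_trace_scale:
  assumes "c ^ Q = c"
  shows "pow_trace Q r (c * x) = c * pow_trace Q r x"
  unfolding pow_trace_def
  by (simp add: power_mult_distrib power_fixed_iterate[OF assms] sum_distrib_left)

text \<open>Raising to the power \<open>Q\<close> shifts the summands by one index, and the last one
  wraps around to the first because \<open>x ^ (Q ^ r) = x\<close>.\<close>

lemma pow_trace_fixed:
  fixes x :: "'a::{finite,field}"
  assumes "Q = CHAR('a) ^ s" "CARD('a) = Q ^ r"
  shows "pow_trace Q r x ^ Q = pow_trace Q r x"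
proof -
  have "pow_trace Q r x ^ Q = (\<Sum>i<r. x ^ (Q ^ Suc i))"
    using char_power_sum[OF assms(1), of "\<lambda>i. x ^ (Q ^ i)" "{..<r}" 1]
    by (simp add: pow_trace_def mult.commute flip: power_mult)
  also have "\<dots> + x = (\<Sum>i<Suc r. x ^ (Q ^ i))"
    by (subst sum.lessThan_Suc_shift) (simp add: add.commute)
  also have "\<dots> = pow_trace Q r x + x"
    using power_CARD_eq_self[of x] by (simp add: pow_trace_def assms(2))
  finally show ?thesis by simp
qed

text \<open>The trace is a polynomial function of degree at most \<open>Q ^ (r - 1)\<close>, less
  than the field size, and its linear coefficient is 1, so it cannot vanish everywhere.\<close>

lemma pow_trace_nonzero:
  assumes "CARD('a::{finite,field}) = Q ^ r" "Q \<ge> 2" "r > 0"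
  shows "\<exists>x::'a. pow_trace Q r x \<noteq> 0"
proof (rule ccontr)
  assume "\<not> ?thesis"
  then have z: "pow_trace Q r x = 0" for x :: 'a by blast
  define P :: "'a poly" where "P = (\<Sum>i<r. monom 1 (Q ^ i))"
  have "coeff P 1 = (\<Sum>i<r. if i = 0 then 1 else 0)"
    unfolding P_def coeff_sum using assms(2) by (intro sum.cong) auto
  then have P0: "P \<noteq> 0" using assms(3) by auto
  have "degree P \<le> Q ^ (r - 1)" unfolding P_def
  proof (intro degree_sum_le)
    fix i assume "i \<in> {..<r}"
    then have "Q ^ i \<le> Q ^ (r - 1)" using assms by (intro power_increasing) auto
    then show "degree (monom (1::'a) (Q ^ i)) \<le> Q ^ (r - 1)"
      by (simp add: degree_monom_eq)
  qed auto
  also have "\<dots> < Q ^ r" using assms by (intro power_strict_increasing) auto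
  finally have "degree P < CARD('a)" using assms by simp
  moreover have "{x. poly P x = 0} = UNIV"
    using z by (auto simp: P_def poly_sum poly_monom pow_trace_def)
  ultimately show False using card_poly_roots_bound[OF P0] by simp
qed

lemma pow_trace_nondegenerate:
  fixes x :: "'a::{finite,field}"
  assumes "CARD('a) = Q ^ r" "Q \<ge> 2" "r > 0" "\<And>t. pow_trace Q r (t * x) = 0"
  shows "x = 0"
proof (rule ccontr)
  assume "x \<noteq> 0"
  obtain y :: 'a where "pow_trace Q r y \<noteq> 0" using pow_trace_nonzero assms by blast
  then show False using assms(4)[of "y / x"] \<open>x \<noteq> 0\<close> by simp
qed

text \<open>The polynomial \<open>X ^ Q - X\<close> has at most \<open>Q\<close> roots, so
  \<open>Q\<close> known ones are all of them. This identifies the prime field and, later, the image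
  of \<phi>.\<close>

lemma power_fixed_points_eq:
  fixes A :: "'a::{finite,field} set"
  assumes "Q \<ge> 2" "card A = Q" "\<And>x. x \<in> A \<Longrightarrow> x ^ Q = x"
  shows "{x. x ^ Q = x} = A"
proof -
  define P :: "'a poly" where "P = monom 1 Q - monom 1 1"
  have "coeff P Q = 1" using assms(1) by (simp add: P_def)
  then have P0: "P \<noteq> 0" by auto
  have "degree P \<le> Q" unfolding P_def
    using assms(1) by (intro degree_diff_le) (auto simp: degree_monom_eq)
  then have "card {x. poly P x = 0} \<le> Q" using card_poly_roots_bound[OF P0] by simp
  moreover have "{x. poly P x = 0} = {x. x ^ Q = x}" by (simp add: P_def poly_monom)
  ultimately have "card {x::'a. x ^ Q = x} \<le> card A" using assms(2) by simp
  moreover have "A \<subseteq> {x. x ^ Q = x}" using assms(3) by auto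
  ultimately show ?thesis by (metis card_seteq finite_code)
qed

section \<open>The additive character and dual codes\<close>

lemma fdeg_works: "0 < fdeg TYPE('a::{finite,field}) \<and> CHAR('a) ^ fdeg TYPE('a) = CARD('a)"
proof -
  have "\<exists>r. 0 < r \<and> CHAR('a) ^ r = CARD('a)" using CARD_prime_power[where 'a='a] by metis
  then show ?thesis unfolding fdeg_def by (rule LeastI_ex)
qed

lemma ftrace_eq_pow_trace: "ftrace (y::'a::{finite,field}) = pow_trace CHAR('a) (fdeg TYPE('a)) y"
  by (simp add: ftrace_def pow_trace_def)

lemma ftrace_add: "ftrace (x + y) = ftrace x + ftrace (y::'a::{finite,field})"
  unfolding ftrace_eq_pow_trace by (rule pow_trace_add[of _ 1]) simp

lemma ftrace_nondegenerate:
  fixes x :: "'a::{finite,field}"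
  assumes "\<And>t. ftrace (t * x) = 0"
  shows "x = 0"
proof (rule pow_trace_nondegenerate)
  show "CARD('a) = CHAR('a) ^ fdeg TYPE('a)" "0 < fdeg TYPE('a)" using fdeg_works[where 'a='a] by auto
  show "CHAR('a) \<ge> 2" by (rule prime_ge_2_nat[OF prime_CHAR_finite])
  show "pow_trace CHAR('a) (fdeg TYPE('a)) (t * x) = 0" for t
    using assms by (simp add: ftrace_eq_pow_trace)
qed

lemma of_nat_power_CHAR: "(of_nat j :: 'a::{finite,field}) ^ CHAR('a) = of_nat j"
proof (induction j)
  case 0
  then show ?case using prime_gt_0_nat[OF prime_CHAR_finite[where 'a='a]] by (simp add: power_0_left)
next
  case (Suc j)
  then show ?case using freshmans_dream[OF prime_CHAR_finite refl, of "1::'a" "of_nat j"] by simp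
qed

lemma of_nat_inj_on_CHAR: "inj_on (of_nat :: nat \<Rightarrow> 'a::{finite,field}) {..<CHAR('a)}"
proof (rule linorder_inj_onI)
  fix i j assume "i < j" "i \<in> {..<CHAR('a)}" "j \<in> {..<CHAR('a)}"
  then have "0 < j - i" "j - i < CHAR('a)" by auto
  then have "\<not> CHAR('a) dvd j - i" by (simp add: nat_dvd_not_less)
  then show "of_nat i \<noteq> (of_nat j :: 'a)" using of_nat_eq_iff_char_dvd[OF \<open>i < j\<close>, where 'a='a] by simp
qed auto

text \<open>Together with \<open>of_nat_inj_on_CHAR\<close> this shows that the \<open>THE\<close>
  in \<open>fchar\<close> is well defined.\<close>

lemma ftrace_prime_field: "\<exists>j<CHAR('a). of_nat j = ftrace (y::'a::{finite,field})"
proof -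
  have "{x::'a. x ^ CHAR('a) = x} = of_nat ` {..<CHAR('a)}"
    by (rule power_fixed_points_eq)
      (auto simp: prime_ge_2_nat[OF prime_CHAR_finite] card_image of_nat_inj_on_CHAR of_nat_power_CHAR)
  moreover have "ftrace y ^ CHAR('a) = ftrace y" unfolding ftrace_eq_pow_trace
    by (rule pow_trace_fixed[of _ 1]) (simp_all add: fdeg_works)
  ultimately have "ftrace y \<in> of_nat ` {..<CHAR('a)}" by blast
  then show ?thesis by auto
qed

lemma omega_power_CHAR: "omega TYPE('a::{finite,field}) ^ CHAR('a) = 1"
  using prime_gt_0_nat[OF prime_CHAR_finite[where 'a='a]] by (simp add: omega_def DeMoivre)

lemma omega_nonzero: "omega TYPE('a::{finite,field}) \<noteq> 0"
  by (simp add: omega_def)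

lemma omega_power_mod: "omega TYPE('a::{finite,field}) ^ (j mod CHAR('a)) = omega TYPE('a) ^ j"
proof -
  have "omega TYPE('a) ^ j = omega TYPE('a) ^ (j mod CHAR('a) + CHAR('a) * (j div CHAR('a)))" by simp
  also have "\<dots> = omega TYPE('a) ^ (j mod CHAR('a))"
    by (simp only: power_add power_mult omega_power_CHAR) simp
  finally show ?thesis by simp
qed

lemma omega_power_eq_1:
  assumes "j < CHAR('a::{finite,field})" "omega TYPE('a) ^ j = 1"
  shows "j = 0"
proof (rule ccontr)
  assume "j \<noteq> 0"
  let ?x = "2 * pi * (real j / real CHAR('a))"
  have "cis ?x = 1" using assms(2) by (simp add: omega_def DeMoivre mult_ac)
  then have "cos ?x = 1" by (metis cis.sel(1) one_complex.sel(1))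
  then obtain k :: int where "?x = real_of_int k * 2 * pi"
    unfolding cos_one_2pi_int by blast
  then have "2 * pi * (real j / real CHAR('a) - real_of_int k) = 0" by (simp add: algebra_simps)
  then have k: "real j / real CHAR('a) = real_of_int k" by simp
  moreover have "0 < real j / real CHAR('a)" "real j / real CHAR('a) < 1" using assms(1) \<open>j \<noteq> 0\<close> by auto
  ultimately have "0 < k" "k < 1" by auto
  then show False by simp
qed

text \<open>Any natural number that represents the trace may serve as exponent, reduced or not;
  additivity of the character follows without carrying residues along.\<close>

lemma fchar_eq:
  assumes "of_nat j = ftrace (y::'a::{finite,field})"
  shows "fchar y = omega TYPE('a) ^ j"
proof -
  have p0: "CHAR('a) > 0" by (rule prime_gt_0_nat[OF prime_CHAR_finite])
  obtain k where k: "k < CHAR('a)" "of_nat k = ftrace y" using ftrace_prime_field by blast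
  have "(THE k. k < CHAR('a) \<and> of_nat k = ftrace y) = k"
    using k inj_onD[OF of_nat_inj_on_CHAR[where 'a='a]] by (intro the_equality) auto
  moreover have "(of_nat (j mod CHAR('a)) :: 'a) = of_nat k"
  proof -
    have "(of_nat j :: 'a) = of_nat (j mod CHAR('a) + CHAR('a) * (j div CHAR('a)))" by (simp only: mod_mult_div_eq)
    then show ?thesis using assms k by (simp only: of_nat_add of_nat_mult of_nat_CHAR) simp
  qed
  then have "j mod CHAR('a) = k"
    using inj_onD[OF of_nat_inj_on_CHAR[where 'a='a]] k(1) p0 by (metis lessThan_iff mod_less_divisor)
  ultimately show ?thesis unfolding fchar_def using omega_power_mod by metis
qed

lemma fchar_0 [simp]: "fchar (0::'a::{finite,field}) = 1"
proof -
  have "ftrace (0::'a) = 0" unfolding ftrace_eq_pow_trace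
    by (rule pow_trace_0) (rule prime_gt_0_nat[OF prime_CHAR_finite])
  then show ?thesis using fchar_eq[of 0 "0::'a"] by simp
qed

lemma fchar_add: "fchar (x + y) = fchar x * fchar (y::'a::{finite,field})"
proof -
  obtain i j where ij: "of_nat i = ftrace x" "of_nat j = ftrace y" using ftrace_prime_field by blast
  then have "of_nat (i + j) = ftrace (x + y)" by (simp add: ftrace_add)
  then show ?thesis using ij fchar_eq by (metis power_add)
qed

lemma fchar_nonzero [simp]: "fchar (x::'a::{finite,field}) \<noteq> 0"
  by (simp add: fchar_def omega_nonzero)

lemma fchar_eq_1_imp_ftrace: "fchar (x::'a::{finite,field}) = 1 \<Longrightarrow> ftrace x = 0"
  by (metis fchar_eq ftrace_prime_field omega_power_eq_1 of_nat_0)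

lemma fchar_nondegenerate:
  fixes x :: "'a::{finite,field}"
  assumes "\<And>t. fchar (t * x) = 1"
  shows "x = 0"
  using assms fchar_eq_1_imp_ftrace ftrace_nondegenerate by blast

lemma fchar_separates:
  fixes x y :: "'a::{finite,field}"
  assumes "\<And>t. fchar (t * x) = fchar (t * y)"
  shows "x = y"
proof -
  have "fchar (t * (x - y)) = 1" for t
  proof -
    have "t * (x - y) + t * y = t * x" by (simp add: algebra_simps)
    then have "fchar (t * (x - y)) * fchar (t * y) = fchar (t * x)" by (metis fchar_add)
    then show ?thesis unfolding assms[of t] by simp
  qed
  then show ?thesis using fchar_nondegenerate[of "x - y"] by simp
qed

section \<open>Dot products, linear codes and their duals\<close>

lemma dotp_commute: "dotp n x y = dotp n y x"
  by (simp add: dotp_def mult.commute)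

lemma dotp_add_left: "dotp n (\<lambda>i. x i + y i) z = dotp n x z + dotp n y z"
  by (simp add: dotp_def algebra_simps sum.distrib)

lemma dotp_add_right: "dotp n z (\<lambda>i. x i + y i) = dotp n z x + dotp n z y"
  by (simp add: dotp_def algebra_simps sum.distrib)

lemma dotp_scale_left: "dotp n (\<lambda>i. c * x i) z = c * dotp n x z"
  by (simp add: dotp_def sum_distrib_left mult.assoc)

lemma dotp_scale_right: "dotp n z (\<lambda>i. c * x i) = c * dotp n z x"
  by (metis dotp_commute dotp_scale_left)

lemma dotp_zero [simp]: "dotp n (\<lambda>_. 0) z = 0" "dotp n z (\<lambda>_. 0) = 0"
  by (simp_all add: dotp_def)

lemma dotp_unit:
  assumes "i < n"
  shows "dotp n x (\<lambda>j. if j = i then t else 0) = t * x i"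
proof -
  have "dotp n x (\<lambda>j. if j = i then t else 0) = (\<Sum>j<n. if j = i then t * x i else 0)"
    unfolding dotp_def by (intro sum.cong refl) (simp add: mult.commute)
  then show ?thesis using assms by simp
qed

lemma zero_vecs [simp]: "(\<lambda>_. 0) \<in> vecs n"
  by (simp add: vecs_def)

lemma bij_betw_vecs_Suc:
  "bij_betw (\<lambda>(f, a). f(n := a)) (vecs n \<times> UNIV) (vecs (Suc n))"
  by (rule bij_betw_byWitness[of _ "\<lambda>g. (g(n := 0), g n)"])
    (auto simp: vecs_def fun_upd_idem)

lemma finite_vecs: "finite (vecs n :: (nat \<Rightarrow> 'a::{finite,zero}) set)"
  and card_vecs: "card (vecs n :: (nat \<Rightarrow> 'a::{finite,zero}) set) = CARD('a) ^ n"
proof (induction n)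
  case 0
  have "vecs 0 = {\<lambda>_. 0 :: 'a}" by (simp add: vecs_def set_eq_iff fun_eq_iff)
  then show "finite (vecs 0 :: (nat \<Rightarrow> 'a) set)" "card (vecs 0 :: (nat \<Rightarrow> 'a) set) = CARD('a) ^ 0" by simp_all
next
  case (Suc n)
  note b = bij_betw_vecs_Suc[of n, where 'a='a]
  show "finite (vecs (Suc n) :: (nat \<Rightarrow> 'a) set)" using bij_betw_finite[OF b] Suc(1) by simp
  show "card (vecs (Suc n) :: (nat \<Rightarrow> 'a) set) = CARD('a) ^ Suc n"
    using bij_betw_same_card[OF b] Suc(2) by (simp add: card_cartesian_product mult.commute)
qed

text \<open>Multiples of the unit vectors isolate one coordinate at a time, where the character
  separates points.\<close>

lemma fchar_dotp_separates:
  fixes x y :: "nat \<Rightarrow> 'a::{finite,field}"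
  assumes "x \<in> vecs n" "y \<in> vecs n" "\<And>z. z \<in> vecs n \<Longrightarrow> fchar (dotp n x z) = fchar (dotp n y z)"
  shows "x = y"
proof
  fix i
  show "x i = y i"
  proof (cases "i < n")
    case True
    have "fchar (t * x i) = fchar (t * y i)" for t
    proof -
      have "(\<lambda>j. if j = i then t else 0) \<in> vecs n" using True by (simp add: vecs_def)
      from assms(3)[OF this] show ?thesis using True by (simp add: dotp_unit)
    qed
    show ?thesis by (rule fchar_separates) fact
  next
    case False
    then show ?thesis using assms by (simp add: vecs_def)
  qed
qed

definition linear_code :: "nat \<Rightarrow> (nat \<Rightarrow> 'a::field) set \<Rightarrow> bool" where
  "linear_code n D \<longleftrightarrow> D \<subseteq> vecs n \<and> (\<lambda>_. 0) \<in> D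
    \<and> (\<forall>x\<in>D. \<forall>y\<in>D. (\<lambda>i. x i + y i) \<in> D) \<and> (\<forall>c. \<forall>x\<in>D. (\<lambda>i. c * x i) \<in> D)"

definition dual_code :: "nat \<Rightarrow> (nat \<Rightarrow> 'a::field) set \<Rightarrow> (nat \<Rightarrow> 'a) set" where
  "dual_code n D = {y \<in> vecs n. \<forall>x\<in>D. dotp n x y = 0}"

lemma linear_codeD:
  assumes "linear_code n D"
  shows linear_code_subset: "D \<subseteq> vecs n"
    and linear_code_zero: "(\<lambda>_. 0) \<in> D"
    and linear_code_add: "x \<in> D \<Longrightarrow> y \<in> D \<Longrightarrow> (\<lambda>i. x i + y i) \<in> D"
    and linear_code_scale: "x \<in> D \<Longrightarrow> (\<lambda>i. c * x i) \<in> D"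
  using assms by (simp_all add: linear_code_def)

lemma linear_code_uminus:
  assumes "linear_code n D" "x \<in> D" shows "(\<lambda>i. - x i) \<in> D"
  using linear_code_scale[OF assms, of "- 1"] by simp

lemma linear_code_diff:
  assumes "linear_code n D" "x \<in> D" "y \<in> D" shows "(\<lambda>i. x i - y i) \<in> D"
  using linear_code_add[OF assms(1,2) linear_code_uminus[OF assms(1,3)]] by simp

lemma linear_code_vecs: "linear_code n (vecs n)"
  by (auto simp: linear_code_def vecs_def)

lemma linear_code_dual: "linear_code n (dual_code n D)"
  by (auto simp: linear_code_def dual_code_def dotp_add_right dotp_scale_right vecs_def)

lemma linear_code_finite:
  "linear_code n D \<Longrightarrow> finite (D :: (nat \<Rightarrow> 'a::{finite,field}) set)"
  using linear_code_subset finite_subset finite_vecs by metis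

text \<open>A linear code is closed under scalars, so orthogonality with respect to the character
  already implies orthogonality for the dot product.\<close>

lemma fchar_trivial_imp_dotp_zero:
  fixes y :: "nat \<Rightarrow> 'a::{finite,field}"
  assumes "linear_code n D" "\<And>x. x \<in> D \<Longrightarrow> fchar (dotp n x y) = 1" "x \<in> D"
  shows "dotp n x y = 0"
proof (rule fchar_nondegenerate)
  fix t
  have "(\<lambda>i. t * x i) \<in> D" by (rule linear_code_scale[OF assms(1,3)])
  then show "fchar (t * dotp n x y) = 1" using assms(2) by (metis dotp_scale_left)
qed

text \<open>Translation by \<open>d\<close> permutes \<open>D\<close> and multiplies the sum by a
  factor other than 1.\<close>

lemma fchar_sum_eq_0:
  fixes y :: "nat \<Rightarrow> 'a::{finite,field}"
  assumes D: "linear_code n D" and d: "d \<in> D" "fchar (dotp n d y) \<noteq> 1"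
  shows "(\<Sum>x\<in>D. fchar (dotp n x y)) = 0"
proof -
  have "(\<Sum>x\<in>D. fchar (dotp n x y)) = (\<Sum>x\<in>D. fchar (dotp n (\<lambda>i. x i + d i) y))"
    by (rule sum.reindex_bij_witness[of _ "\<lambda>x i. x i + d i" "\<lambda>x i. x i - d i"])
      (simp_all only: diff_add_cancel add_diff_cancel_right' linear_code_add[OF D _ d(1)] linear_code_diff[OF D _ d(1)])
  also have "\<dots> = (\<Sum>x\<in>D. fchar (dotp n x y)) * fchar (dotp n d y)"
    by (simp add: dotp_add_left fchar_add sum_distrib_right)
  finally show ?thesis using d(2) by simp
qed

text \<open>The sum of \<open>fchar (dotp n x y)\<close> over \<open>x\<close> in \<open>D\<close>
  and all \<open>y\<close> is evaluated in both orders: for fixed \<open>y\<close> only dual words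
  contribute, for fixed \<open>x\<close> only the zero word does.\<close>

lemma card_dual_code:
  fixes D :: "(nat \<Rightarrow> 'a::{finite,field}) set"
  assumes D: "linear_code n D"
  shows "card D * card (dual_code n D) = CARD('a) ^ n"
proof -
  have D0: "(\<lambda>_. 0) \<in> D" and Dv: "D \<subseteq> vecs n" by (fact linear_codeD[OF D])+
  note finD = linear_code_finite[OF D]
  have "(\<Sum>y\<in>vecs n. \<Sum>x\<in>D. fchar (dotp n x y)) = (\<Sum>y\<in>vecs n. if y \<in> dual_code n D then of_nat (card D) else 0)"
  proof (rule sum.cong[OF refl])
    fix y :: "nat \<Rightarrow> 'a" assume y: "y \<in> vecs n"
    show "(\<Sum>x\<in>D. fchar (dotp n x y)) = (if y \<in> dual_code n D then of_nat (card D) else 0)"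
    proof (cases "y \<in> dual_code n D")
      case True
      then show ?thesis by (simp add: dual_code_def)
    next
      case False
      then obtain d where "d \<in> D" "fchar (dotp n d y) \<noteq> 1"
        using fchar_trivial_imp_dotp_zero[OF D] y unfolding dual_code_def by blast
      then show ?thesis using fchar_sum_eq_0[OF D] False by simp
    qed
  qed
  also have "\<dots> = of_nat (card D) * of_nat (card (dual_code n D))"
  proof -
    have "vecs n \<inter> dual_code n D = dual_code n D" by (auto simp: dual_code_def)
    then show ?thesis by (simp add: sum.If_cases finite_vecs)
  qed
  finally have 1: "(\<Sum>y\<in>vecs n. \<Sum>x\<in>D. fchar (dotp n x y)) = of_nat (card D * card (dual_code n D))" by simp
  have "(\<Sum>x\<in>D. \<Sum>y\<in>vecs n. fchar (dotp n x y)) = (\<Sum>x\<in>D. if x = (\<lambda>_. 0) then of_nat (CARD('a) ^ n) else 0)"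
  proof (rule sum.cong[OF refl])
    fix x assume x: "x \<in> D"
    show "(\<Sum>y\<in>vecs n. fchar (dotp n x y)) = (if x = (\<lambda>_. 0) then of_nat (CARD('a) ^ n) else 0)"
    proof (cases "x = (\<lambda>_. 0)")
      case True
      then show ?thesis by (simp add: card_vecs)
    next
      case False
      then obtain d where "d \<in> vecs n" "fchar (dotp n d x) \<noteq> 1"
        using fchar_dotp_separates[of x n "\<lambda>_. 0"] x Dv by (auto simp: dotp_commute)
      then have "(\<Sum>y\<in>vecs n. fchar (dotp n y x)) = 0" by (rule fchar_sum_eq_0[OF linear_code_vecs])
      then show ?thesis using False by (simp add: dotp_commute[of n x])
    qed
  qed
  also have "\<dots> = of_nat (CARD('a) ^ n)" using D0 finD by (simp add: sum.delta)
  finally have "(of_nat (card D * card (dual_code n D)) :: complex) = of_nat (CARD('a) ^ n)"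
    using 1 sum.swap[of "\<lambda>x y. fchar (dotp n x y)" "vecs n" D] by simp
  then show ?thesis using of_nat_eq_iff by blast
qed

section \<open>Pauli operators and the CSS stabilizer\<close>

lemma vecs_add: "x \<in> vecs n \<Longrightarrow> y \<in> vecs n \<Longrightarrow> (\<lambda>i. x i + y i) \<in> vecs n"
  for x :: "nat \<Rightarrow> 'a::field"
  by (rule linear_code_add[OF linear_code_vecs])

text \<open>The scalar is the phase picked up when \<open>Z(b)\<close> is moved past
  \<open>X(a')\<close>.\<close>

lemma pauli_comp:
  "pauli n c a b \<circ> pauli n c' a' b' =
    (\<lambda>f y. fchar (dotp n b a') * pauli n (c + c') (\<lambda>i. a i + a' i) (\<lambda>i. b i + b' i) f y)"
proof (intro ext)
  fix f :: "(nat \<Rightarrow> 'a) \<Rightarrow> complex" and y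
  have *: "y i - a i = (y i - (a i + a' i)) + a' i" for i by simp
  have "dotp n b (\<lambda>i. y i - a i) = dotp n b (\<lambda>i. y i - (a i + a' i)) + dotp n b a'"
    by (subst *) (rule dotp_add_right)
  then show "(pauli n c a b \<circ> pauli n c' a' b') f y =
      fchar (dotp n b a') * pauli n (c + c') (\<lambda>i. a i + a' i) (\<lambda>i. b i + b' i) f y"
    by (simp add: pauli_def dotp_add_left fchar_add power_add diff_diff_eq)
qed

text \<open>Two test functions suffice: the point mass at the zero word reveals the shift
  \<open>a\<close>, and the constant 1 reveals the character of \<open>b\<close> together with the
  phase. The constant lies outside \<open>hspace n\<close>, but operators are compared on all
  functions.\<close>

lemma pauli_scaled_inject:
  fixes a b a' b' :: "nat \<Rightarrow> 'a::{finite,field}"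
  assumes eq: "(\<lambda>f y. u * pauli n c a b f y) = (\<lambda>f y. v * pauli n c' a' b' f y)"
    and "u \<noteq> 0" and v: "a \<in> vecs n" "b \<in> vecs n" "a' \<in> vecs n" "b' \<in> vecs n"
  shows "a = a'" "b = b'" "u * omega TYPE('a) ^ c = v * omega TYPE('a) ^ c'"
proof -
  have eq': "u * pauli n c a b f y = v * pauli n c' a' b' f y" for f y
    using eq by (metis (no_types))
  show a: "a = a'"
  proof (rule ccontr)
    assume "a \<noteq> a'"
    then have "(\<lambda>i. a i - a' i) \<noteq> (\<lambda>_. 0)" by (auto simp: fun_eq_iff)
    then show False
      using eq'[of "\<lambda>x. if x = (\<lambda>_. 0) then 1 else 0" a] \<open>u \<noteq> 0\<close>
      by (simp add: pauli_def omega_nonzero)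
  qed
  have *: "u * omega TYPE('a) ^ c * fchar (dotp n b x) = v * omega TYPE('a) ^ c' * fchar (dotp n b' x)" for x
    using eq'[of "\<lambda>_. 1" "\<lambda>i. x i + a i"] by (simp add: pauli_def mult.assoc flip: a)
  show c: "u * omega TYPE('a) ^ c = v * omega TYPE('a) ^ c'"
    using *[of "\<lambda>_. 0"] by simp
  show "b = b'"
  proof (rule fchar_dotp_separates[OF v(2,4)])
    fix x :: "nat \<Rightarrow> 'a"
    show "fchar (dotp n b x) = fchar (dotp n b' x)"
      using *[of x, folded c] \<open>u \<noteq> 0\<close> omega_nonzero[where 'a='a] by simp
  qed
qed

lemma pauli_inject:
  fixes a b a' b' :: "nat \<Rightarrow> 'a::{finite,field}"
  assumes "pauli n c a b = pauli n c' a' b'"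
    and "a \<in> vecs n" "b \<in> vecs n" "a' \<in> vecs n" "b' \<in> vecs n"
  shows "a = a'" "b = b'"
  using pauli_scaled_inject[of 1 n c a b 1 c' a' b'] assms by simp_all

text \<open>By injectivity the \<open>LEAST\<close> ranges over a single value.\<close>

lemma pweight_pauli:
  fixes a b :: "nat \<Rightarrow> 'a::{finite,field}"
  assumes "a \<in> vecs n" "b \<in> vecs n"
  shows "pweight n (pauli n c a b) = card {i. i < n \<and> (a i \<noteq> 0 \<or> b i \<noteq> 0)}"
  unfolding pweight_def
proof (rule Least_equality)
  fix w
  assume "\<exists>c' a' b'. a' \<in> vecs n \<and> b' \<in> vecs n \<and> pauli n c a b = pauli n c' a' b'
    \<and> w = card {i. i < n \<and> (a' i \<noteq> 0 \<or> b' i \<noteq> 0)}"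
  then obtain c' a' b' where w: "a' \<in> vecs n" "b' \<in> vecs n" "pauli n c a b = pauli n c' a' b'"
    "w = card {i. i < n \<and> (a' i \<noteq> 0 \<or> b' i \<noteq> 0)}" by blast
  show "card {i. i < n \<and> (a i \<noteq> 0 \<or> b i \<noteq> 0)} \<le> w"
    using pauli_inject[OF w(3) assms w(1,2)] w(4) by simp
qed (use assms in blast)

lemma hweight_le_pweight:
  fixes a b :: "nat \<Rightarrow> 'a::{finite,field}"
  assumes "a \<in> vecs n" "b \<in> vecs n"
  shows "hweight n a \<le> pweight n (pauli n c a b)" "hweight n b \<le> pweight n (pauli n c a b)"
  unfolding pweight_pauli[OF assms] hweight_def by (auto intro!: card_mono)

lemma pauli_identity: "pauli n 0 (\<lambda>_. 0) (\<lambda>_. 0) = id"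
  by (simp add: pauli_def fun_eq_iff)

lemma pauli_phase_cong:
  fixes a b :: "nat \<Rightarrow> 'a::{finite,field}"
  assumes "omega TYPE('a) ^ c = omega TYPE('a) ^ c'"
  shows "pauli n c a b = pauli n c' a b"
  by (simp add: pauli_def assms fun_eq_iff)

text \<open>Self-orthogonality of \<open>D\<close> makes these operators of phase zero closed under composition, in even characteristic too.\<close>
definition css_stabilizer :: "nat \<Rightarrow> (nat \<Rightarrow> 'a::{finite,field}) set \<Rightarrow> 'a qop set" where
  "css_stabilizer n D = {pauli n 0 a b | a b. a \<in> D \<and> b \<in> D}"

locale self_orthogonal_code =
  fixes n :: nat and D :: "(nat \<Rightarrow> 'a::{finite,field}) set"
  assumes linear: "linear_code n D" and self_orthogonal: "D \<subseteq> dual_code n D"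
begin

lemma D_vecs: "x \<in> D \<Longrightarrow> x \<in> vecs n"
  using linear_code_subset[OF linear] by blast

lemma dual_vecs: "x \<in> dual_code n D \<Longrightarrow> x \<in> vecs n"
  by (simp add: dual_code_def)

lemma dotp_dual: "x \<in> D \<Longrightarrow> y \<in> dual_code n D \<Longrightarrow> dotp n x y = 0"
  by (simp add: dual_code_def)

lemma dotp_D: "x \<in> D \<Longrightarrow> y \<in> D \<Longrightarrow> dotp n x y = 0"
  using dotp_dual self_orthogonal by blast

lemma pauli_comp_D:
  assumes "b \<in> D" "a' \<in> D"
  shows "pauli n c a b \<circ> pauli n c' a' b' = pauli n (c + c') (\<lambda>i. a i + a' i) (\<lambda>i. b i + b' i)"
  unfolding pauli_comp dotp_D[OF assms] by simp

lemma css_abelian: "abelian_pauli_subgroup n (css_stabilizer n D)"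
  unfolding abelian_pauli_subgroup_def
proof (intro conjI ballI)
  show "css_stabilizer n D \<subseteq> pauli_group n"
    unfolding css_stabilizer_def pauli_group_def using D_vecs by blast
  show "id \<in> css_stabilizer n D"
    unfolding css_stabilizer_def using linear_code_zero[OF linear] pauli_identity by (metis (mono_tags, lifting) mem_Collect_eq)
next
  fix E F assume "E \<in> css_stabilizer n D" "F \<in> css_stabilizer n D"
  then obtain a b a' b' where ab: "a \<in> D" "b \<in> D" "a' \<in> D" "b' \<in> D"
    and E: "E = pauli n 0 a b" and F: "F = pauli n 0 a' b'"
    unfolding css_stabilizer_def by blast
  have "E \<circ> F = pauli n 0 (\<lambda>i. a i + a' i) (\<lambda>i. b i + b' i)"
    using pauli_comp_D[OF ab(2,3)] E F by simp
  moreover have "F \<circ> E = pauli n 0 (\<lambda>i. a i + a' i) (\<lambda>i. b i + b' i)"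
    using pauli_comp_D[OF ab(4,1)] E F by (simp add: add.commute)
  ultimately show "E \<circ> F \<in> css_stabilizer n D" "E \<circ> F = F \<circ> E"
    unfolding css_stabilizer_def
    using linear_code_add[OF linear ab(1,3)] linear_code_add[OF linear ab(2,4)] by auto
next
  fix E assume "E \<in> css_stabilizer n D"
  then obtain a b where ab: "a \<in> D" "b \<in> D" and E: "E = pauli n 0 a b"
    unfolding css_stabilizer_def by blast
  note neg = linear_code_uminus[OF linear ab(1)] linear_code_uminus[OF linear ab(2)]
  show "\<exists>F\<in>css_stabilizer n D. F \<circ> E = id"
  proof
    show "pauli n 0 (\<lambda>i. - a i) (\<lambda>i. - b i) \<circ> E = id"
      unfolding E pauli_comp_D[OF neg(2) ab(1)] by (simp add: pauli_identity)
    show "pauli n 0 (\<lambda>i. - a i) (\<lambda>i. - b i) \<in> css_stabilizer n D"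
      unfolding css_stabilizer_def using neg by blast
  qed
qed

text \<open>Comparing the two sides of \<open>E \<circ> F = F' \<circ> E\<close> forces
  \<open>F'\<close> to have the same \<open>Z\<close>-part as \<open>F\<close>. Since stabilizer
  elements are written with phase zero, the commutation phases must then agree.\<close>

lemma normalizer_fchar_eq:
  assumes E: "pauli n c a b \<in> normalizer n (css_stabilizer n D)"
    and v: "a \<in> vecs n" "b \<in> vecs n" and ab': "a' \<in> D" "b' \<in> D"
  shows "fchar (dotp n b a') = fchar (dotp n b' a)"
proof -
  have "pauli n 0 a' b' \<in> css_stabilizer n D" unfolding css_stabilizer_def using ab' by blast
  then obtain F where F: "F \<in> css_stabilizer n D" "pauli n c a b \<circ> pauli n 0 a' b' = F \<circ> pauli n c a b"
    using E unfolding normalizer_def by blast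
  obtain a2 b2 where ab2: "a2 \<in> D" "b2 \<in> D" "F = pauli n 0 a2 b2"
    using F(1) unfolding css_stabilizer_def by blast
  note e = F(2)[unfolded ab2(3) pauli_comp]
  note i = pauli_scaled_inject[OF e fchar_nonzero vecs_add[OF v(1) D_vecs[OF ab'(1)]]
      vecs_add[OF v(2) D_vecs[OF ab'(2)]] vecs_add[OF D_vecs[OF ab2(1)] v(1)]
      vecs_add[OF D_vecs[OF ab2(2)] v(2)]]
  have "b2 = b'" using i(2) by (auto simp: fun_eq_iff)
  then show ?thesis using i(3) omega_nonzero[where 'a='a] by simp
qed

text \<open>Taking \<open>a'\<close> or \<open>b'\<close> to be zero decouples the condition into
  one on \<open>a\<close> and one on \<open>b\<close>.\<close>

lemma normalizer_dual:
  assumes E: "pauli n c a b \<in> normalizer n (css_stabilizer n D)"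
    and v: "a \<in> vecs n" "b \<in> vecs n"
  shows "a \<in> dual_code n D" "b \<in> dual_code n D"
proof -
  have "fchar (dotp n b' a) = 1" if "b' \<in> D" for b'
    using normalizer_fchar_eq[OF E v linear_code_zero[OF linear] that] by simp
  then show "a \<in> dual_code n D"
    using fchar_trivial_imp_dotp_zero[OF linear] v unfolding dual_code_def by blast
  have "fchar (dotp n a' b) = 1" if "a' \<in> D" for a'
    using normalizer_fchar_eq[OF E v that linear_code_zero[OF linear]] by (simp add: dotp_commute)
  then show "b \<in> dual_code n D"
    using fchar_trivial_imp_dotp_zero[OF linear] v unfolding dual_code_def by blast
qed

lemma undetectable_cases:
  assumes "E \<in> undetectable n (css_stabilizer n D)"
  obtains c a b where "E = pauli n c a b" "a \<in> dual_code n D" "b \<in> dual_code n D"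
    "a \<noteq> (\<lambda>_. 0) \<or> b \<noteq> (\<lambda>_. 0)"
proof -
  obtain c a b where E: "E = pauli n c a b" and v: "a \<in> vecs n" "b \<in> vecs n"
    using assms unfolding undetectable_def normalizer_def pauli_group_def by blast
  have d: "a \<in> dual_code n D" "b \<in> dual_code n D"
    using normalizer_dual[of c a b] assms E v unfolding undetectable_def by blast+
  moreover have "a \<noteq> (\<lambda>_. 0) \<or> b \<noteq> (\<lambda>_. 0)"
  proof (rule ccontr)
    assume "\<not> ?thesis"
    then have 0: "a = (\<lambda>_. 0)" "b = (\<lambda>_. 0)" by auto
    \<comment> \<open>This phase exponent complements \<open>c\<close> to a multiple of the
      characteristic, so the scalar error becomes the identity, which lies in the
      stabilizer.\<close>
    let ?c = "c * (CHAR('a) - 1)"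
    have p: "CHAR('a) \<noteq> 0" using prime_CHAR_finite[where 'a='a] by (metis not_prime_0)
    have "?c + c = CHAR('a) * c" using p by (cases "CHAR('a)") auto
    then have "pauli n ?c (\<lambda>_. 0) (\<lambda>_. 0) \<circ> E = pauli n (CHAR('a) * c) (\<lambda>_. 0) (\<lambda>_. 0)"
      using pauli_comp_D[OF linear_code_zero[OF linear] linear_code_zero[OF linear]] E 0 by simp
    also have "\<dots> = pauli n 0 (\<lambda>_. 0) (\<lambda>_. 0)"
      by (rule pauli_phase_cong) (simp add: power_mult omega_power_CHAR)
    also have "\<dots> \<in> css_stabilizer n D"
      unfolding css_stabilizer_def using linear_code_zero[OF linear] by blast
    finally show False using assms unfolding undetectable_def by blast
  qed
  ultimately show ?thesis using that E by blast
qed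

lemma css_qdist_ge:
  assumes "\<And>x. x \<in> dual_code n D \<Longrightarrow> x \<noteq> (\<lambda>_. 0) \<Longrightarrow> d \<le> hweight n x"
  shows "qdist_ge n (css_stabilizer n D) d"
  unfolding qdist_ge_def
proof
  fix E assume "E \<in> undetectable n (css_stabilizer n D)"
  then obtain c a b where E: "E = pauli n c a b" and d: "a \<in> dual_code n D" "b \<in> dual_code n D"
    and nz: "a \<noteq> (\<lambda>_. 0) \<or> b \<noteq> (\<lambda>_. 0)" by (rule undetectable_cases)
  show "d \<le> pweight n E"
    using nz assms[OF d(1)] assms[OF d(2)] hweight_le_pweight[OF dual_vecs[OF d(1)] dual_vecs[OF d(2)], of c] E
    by (meson order_trans)
qed

lemma css_pure_upto:
  assumes "\<And>x. x \<in> D \<Longrightarrow> x \<noteq> (\<lambda>_. 0) \<Longrightarrow> t \<le> hweight n x"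
  shows "pure_upto n (css_stabilizer n D) t"
  unfolding pure_upto_def
proof (intro ballI impI)
  fix E assume "E \<in> css_stabilizer n D" and w: "pweight n E < t"
  then obtain a b where d: "a \<in> D" "b \<in> D" and E: "E = pauli n 0 a b"
    unfolding css_stabilizer_def by blast
  have "a = (\<lambda>_. 0)" "b = (\<lambda>_. 0)"
    using w assms[OF d(1)] assms[OF d(2)] hweight_le_pweight[OF D_vecs[OF d(1)] D_vecs[OF d(2)], of 0] E
    by (meson leD order_trans)+
  then show "scalar_op n E" unfolding scalar_op_def using E by blast
qed

text \<open>These pure \<open>X\<close>-errors are the witnesses that attain the minimum
  distance.\<close>

lemma undetectable_dual_minus_D:
  assumes x: "x \<in> dual_code n D" "x \<notin> D"
  shows "pauli n 0 x (\<lambda>_. 0) \<in> undetectable n (css_stabilizer n D)"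
  unfolding undetectable_def normalizer_def
proof (safe)
  show "pauli n 0 x (\<lambda>_. 0) \<in> pauli_group n"
    unfolding pauli_group_def using dual_vecs[OF x(1)] zero_vecs by blast
next
  fix F assume F: "F \<in> css_stabilizer n D"
  then obtain a b where ab: "a \<in> D" "b \<in> D" "F = pauli n 0 a b"
    unfolding css_stabilizer_def by blast
  have "pauli n 0 x (\<lambda>_. 0) \<circ> F = F \<circ> pauli n 0 x (\<lambda>_. 0)"
    unfolding ab(3) pauli_comp dotp_dual[OF ab(2) x(1)] by (simp add: add.commute)
  then show "\<exists>F'\<in>css_stabilizer n D. pauli n 0 x (\<lambda>_. 0) \<circ> F = F' \<circ> pauli n 0 x (\<lambda>_. 0)"
    using F by blast
next
  fix c assume "pauli n c (\<lambda>_. 0) (\<lambda>_. 0) \<circ> pauli n 0 x (\<lambda>_. 0) \<in> css_stabilizer n D"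
  then obtain a b where ab: "a \<in> D" "b \<in> D"
    and eq: "pauli n c (\<lambda>_. 0) (\<lambda>_. 0) \<circ> pauli n 0 x (\<lambda>_. 0) = pauli n 0 a b"
    unfolding css_stabilizer_def by blast
  have "pauli n c x (\<lambda>_. 0) = pauli n 0 a b" using eq unfolding pauli_comp by simp
  then have "x = a" by (rule pauli_inject) (simp_all add: dual_vecs[OF x(1)] D_vecs ab)
  then show False using ab x by simp
qed

text \<open>The strict weight bound on \<open>D\<close> puts a minimum weight word of the dual
  outside \<open>D\<close>, so its \<open>X\<close>-operator is undetectable.\<close>

lemma css_qmin_dist:
  assumes d: "classical_min_dist n (dual_code n D) d"
    and D: "\<And>x. x \<in> D \<Longrightarrow> x \<noteq> (\<lambda>_. 0) \<Longrightarrow> d < hweight n x"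
  shows "qmin_dist n (css_stabilizer n D) d"
  unfolding qmin_dist_def
proof
  show "qdist_ge n (css_stabilizer n D) d"
    using d unfolding classical_min_dist_def by (intro css_qdist_ge) blast
  obtain x where x: "x \<in> dual_code n D" "x \<noteq> (\<lambda>_. 0)" "hweight n x = d"
    using d unfolding classical_min_dist_def by blast
  then have "x \<notin> D" using D by blast
  moreover have "pweight n (pauli n 0 x (\<lambda>_. 0)) = d"
    using x dual_vecs[OF x(1)] by (simp add: pweight_pauli hweight_def)
  ultimately show "\<exists>E\<in>undetectable n (css_stabilizer n D). pweight n E = d"
    using undetectable_dual_minus_D[OF x(1)] by blast
qed

end

section \<open>Dimension of the stabilized space\<close>

text \<open>Gives access to \<open>independent_span_bound\<close>, which proves minimality in the
  \<open>LEAST\<close> of \<open>cdim\<close>.\<close>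

interpretation complex_fun: vector_space "\<lambda>(c::complex) (f::'x \<Rightarrow> complex) x. c * f x"
  by unfold_locales (auto simp: fun_eq_iff algebra_simps)

lemma sum_fun_apply: "(\<Sum>i\<in>A. f i) x = (\<Sum>i\<in>A. f i x)" for f :: "'i \<Rightarrow> 'x \<Rightarrow> 'b::comm_monoid_add"
  by (induction A rule: infinite_finite_induct) auto

lemma cspan_subset_span: "cspan vs k \<subseteq> complex_fun.span (vs ` {..<k})"
proof
  fix v assume "v \<in> cspan vs k"
  then obtain c where "v = (\<lambda>x. \<Sum>j<k. c j * vs j x)" unfolding cspan_def by blast
  then have "v = (\<Sum>j<k. (\<lambda>x. c j * vs j x))" by (simp add: fun_eq_iff sum_fun_apply)
  also have "\<dots> \<in> complex_fun.span (vs ` {..<k})"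
    by (intro complex_fun.span_sum complex_fun.span_scale complex_fun.span_base) auto
  finally show "v \<in> complex_fun.span (vs ` {..<k})" .
qed

text \<open>The indicator functions of the blocks form a basis.\<close>

lemma cdim_partition_constant:
  fixes P :: "'x set set"
  assumes fin: "finite P" and disj: "disjoint P" and ne: "{} \<notin> P"
  shows "cdim {v :: 'x \<Rightarrow> complex. (\<forall>y. y \<notin> \<Union>P \<longrightarrow> v y = 0) \<and> (\<forall>X\<in>P. \<forall>x\<in>X. \<forall>y\<in>X. v x = v y)} = card P"
    (is "cdim ?V = _")
proof -
  define ind where "ind X x = (if x \<in> X then 1 else 0 :: complex)" for X and x :: 'x
  have ind_eq: "ind X x = (if X = Y then 1 else 0)" if "X \<in> P" "Y \<in> P" "x \<in> Y" for X Y x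
  proof (cases "X = Y")
    case True
    then show ?thesis using that by (simp add: ind_def)
  next
    case False
    then have "X \<inter> Y = {}" using disj that unfolding disjoint_def by blast
    then show ?thesis using that False by (auto simp: ind_def)
  qed
  have indV: "ind X \<in> ?V" if X: "X \<in> P" for X
  proof -
    have "ind X x = ind X y" if "Y \<in> P" "x \<in> Y" "y \<in> Y" for x y Y
      using ind_eq[OF X that(1,2)] ind_eq[OF X that(1,3)] by simp
    moreover have "ind X y = 0" if "y \<notin> \<Union>P" for y
      using that X unfolding ind_def by auto
    ultimately show ?thesis by blast
  qed
  have inj: "inj_on ind P"
  proof (rule inj_onI)
    fix X Y assume "X \<in> P" "Y \<in> P" "ind X = ind Y"
    then show "X = Y" by (metis ind_def subsetI subset_antisym zero_neq_one)
  qed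
  have sum_at: "(\<Sum>X\<in>P. g X * ind X x) = g Y" if "Y \<in> P" "x \<in> Y" for g Y x
  proof -
    have "(\<Sum>X\<in>P. g X * ind X x) = (\<Sum>X\<in>P. if X = Y then g X else 0)"
      using ind_eq[OF _ that] by (intro sum.cong refl) simp
    then show ?thesis using that fin by simp
  qed
  have indep: "complex_fun.independent (ind ` P)"
  proof (rule complex_fun.independent_if_scalars_zero)
    show "finite (ind ` P)" using fin by simp
    fix f x assume s: "(\<Sum>v\<in>ind ` P. (\<lambda>y. f v * v y)) = 0" and "x \<in> ind ` P"
    then obtain Y where Y: "Y \<in> P" "x = ind Y" by blast
    obtain y where y: "y \<in> Y" using ne Y by (metis ex_in_conv)
    have "0 = (\<Sum>v\<in>ind ` P. f v * v y)" using s sum_fun_apply[of "\<lambda>v y. f v * v y" "ind ` P" y] by simp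
    also have "\<dots> = (\<Sum>X\<in>P. f (ind X) * ind X y)" by (simp add: sum.reindex[OF inj])
    also have "\<dots> = f x" using sum_at[OF Y(1) y, of "\<lambda>X. f (ind X)"] Y by simp
    finally show "f x = 0" by simp
  qed
  obtain e where e: "bij_betw e {..<card P} P"
    using ex_bij_betw_nat_finite[OF fin] by (auto simp: atLeast0LessThan)
  have reidx: "(\<Sum>j<card P. g (e j)) = (\<Sum>X\<in>P. g X)" for g :: "'x set \<Rightarrow> complex"
    by (rule sum.reindex_bij_betw[OF e])
  have "?V = cspan (\<lambda>j. ind (e j)) (card P)"
  proof (intro equalityI subsetI)
    fix v assume v: "v \<in> ?V"
    define g where "g X = v (SOME x. x \<in> X)" for X
    have "v = (\<lambda>x. \<Sum>j<card P. g (e j) * ind (e j) x)"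
    proof
      fix x
      have "(\<Sum>j<card P. g (e j) * ind (e j) x) = (\<Sum>X\<in>P. g X * ind X x)"
        by (rule reidx)
      also have "\<dots> = v x"
      proof (cases "x \<in> \<Union>P")
        case True
        then obtain Y where Y: "Y \<in> P" "x \<in> Y" by blast
        then have "(SOME x. x \<in> Y) \<in> Y" by (metis someI)
        then have "g Y = v x" unfolding g_def using v Y by blast
        then show ?thesis using sum_at[OF Y] by simp
      next
        case False
        then have "ind X x = 0" if "X \<in> P" for X using that by (auto simp: ind_def)
        moreover have "v x = 0" using v False by blast
        ultimately show ?thesis by simp
      qed
      finally show "v x = (\<Sum>j<card P. g (e j) * ind (e j) x)" by simp
    qed
    then show "v \<in> cspan (\<lambda>j. ind (e j)) (card P)"
      unfolding cspan_def by (intro CollectI exI[of _ "\<lambda>j. g (e j)"] conjI) auto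
  next
    fix v assume "v \<in> cspan (\<lambda>j. ind (e j)) (card P)"
    then obtain c where c: "v = (\<lambda>x. \<Sum>j<card P. c j * ind (e j) x)" unfolding cspan_def by blast
    have eP: "e j \<in> P" if "j < card P" for j using e that by (auto simp: bij_betw_def)
    have "v x = v y" if "X \<in> P" "x \<in> X" "y \<in> X" for X x y
      unfolding c using ind_eq[OF eP that(1,2)] ind_eq[OF eP that(1,3)] by (intro sum.cong refl) simp
    moreover have "v y = 0" if "y \<notin> \<Union>P" for y
    proof -
      have "ind (e j) y = 0" if "j < card P" for j using eP[OF that] \<open>y \<notin> \<Union>P\<close> by (auto simp: ind_def)
      then show ?thesis unfolding c by simp
    qed
    ultimately show "v \<in> ?V" by blast
  qed
  then have ex: "\<exists>vs. ?V = cspan vs (card P)" by blast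
  show ?thesis unfolding cdim_def
  proof (rule Least_equality)
    show "\<exists>vs. ?V = cspan vs (card P)" by (rule ex)
    fix k assume "\<exists>vs. ?V = cspan vs k"
    then obtain vs where vs: "?V = cspan vs k" by blast
    have "ind ` P \<subseteq> complex_fun.span (vs ` {..<k})"
      using indV cspan_subset_span[of vs k] unfolding vs by blast
    then have "card (ind ` P) \<le> card (vs ` {..<k})"
      using complex_fun.independent_span_bound[OF _ indep] by simp
    also have "\<dots> \<le> k" using card_image_le[of "{..<k}" vs] by simp
    finally show "card P \<le> k" by (simp add: card_image[OF inj])
  qed
qed

context self_orthogonal_code
begin

text \<open>The operators with \<open>a = 0\<close> force the support into the dual code, those with
  \<open>b = 0\<close> force invariance under translation by \<open>D\<close>. Conversely, the phase
  is 1 on the dual code, and off it both sides vanish.\<close>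

lemma fixed_space_css:
  "fixed_space n (css_stabilizer n D) =
    {v. (\<forall>y. y \<notin> dual_code n D \<longrightarrow> v y = 0) \<and> (\<forall>a\<in>D. \<forall>y. v (\<lambda>i. y i - a i) = v y)}" (is "_ = ?W")
proof (intro equalityI subsetI)
  fix v assume v: "v \<in> fixed_space n (css_stabilizer n D)"
  have fix_v: "fchar (dotp n b (\<lambda>i. y i - a i)) * v (\<lambda>i. y i - a i) = v y"
    if "a \<in> D" "b \<in> D" for a b y
  proof -
    have "pauli n 0 a b \<in> css_stabilizer n D" unfolding css_stabilizer_def using that by blast
    then have "pauli n 0 a b v = v" using v unfolding fixed_space_def by blast
    then have "pauli n 0 a b v y = v y" by simp
    then show ?thesis by (simp add: pauli_def)
  qed
  have "v y = 0" if y: "y \<notin> dual_code n D" for y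
  proof (cases "y \<in> vecs n")
    case True
    then obtain b where b: "b \<in> D" "fchar (dotp n b y) \<noteq> 1"
      using y fchar_trivial_imp_dotp_zero[OF linear] unfolding dual_code_def by blast
    have "fchar (dotp n b y) * v y = v y"
      using fix_v[OF linear_code_zero[OF linear] b(1), of y] by simp
    then show ?thesis using b(2) by simp
  next
    case False
    then show ?thesis using v unfolding fixed_space_def hspace_def by blast
  qed
  moreover have "v (\<lambda>i. y i - a i) = v y" if "a \<in> D" for a y
    using fix_v[OF that linear_code_zero[OF linear], of y] by simp
  ultimately show "v \<in> ?W" by blast
next
  fix v assume v: "v \<in> ?W"
  have "v \<in> hspace n" using v unfolding hspace_def dual_code_def by blast
  moreover have "pauli n 0 a b v = v" if "a \<in> D" "b \<in> D" for a b
  proof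
    fix y
    have inv: "v (\<lambda>i. y i - a i) = v y" using v that(1) by blast
    show "pauli n 0 a b v y = v y"
    proof (cases "(\<lambda>i. y i - a i) \<in> dual_code n D")
      case True
      then show ?thesis using dotp_dual[OF that(2)] inv by (simp add: pauli_def)
    next
      case False
      then have "v (\<lambda>i. y i - a i) = 0" using v by blast
      then show ?thesis using inv by (simp add: pauli_def)
    qed
  qed
  ultimately show "v \<in> fixed_space n (css_stabilizer n D)"
    unfolding fixed_space_def css_stabilizer_def by blast
qed

definition coset :: "(nat \<Rightarrow> 'a) \<Rightarrow> (nat \<Rightarrow> 'a) set" where
  "coset y = {z. (\<lambda>i. z i - y i) \<in> D}"

lemma coset_self: "y \<in> coset y"
  using linear_code_zero[OF linear] by (simp add: coset_def)

lemma coset_eq: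
  assumes "z \<in> coset y" shows "coset z = coset y"
proof -
  have zy: "(\<lambda>i. z i - y i) \<in> D" using assms by (simp add: coset_def)
  have "(\<lambda>i. w i - y i) \<in> D" if "(\<lambda>i. w i - z i) \<in> D" for w
    using linear_code_add[OF linear that zy] by simp
  moreover have "(\<lambda>i. w i - z i) \<in> D" if "(\<lambda>i. w i - y i) \<in> D" for w
    using linear_code_diff[OF linear that zy] by simp
  ultimately show ?thesis unfolding coset_def by blast
qed

lemma coset_dual:
  assumes "y \<in> dual_code n D" "z \<in> coset y" shows "z \<in> dual_code n D"
proof -
  have "(\<lambda>i. z i - y i) \<in> dual_code n D" using assms(2) self_orthogonal by (auto simp: coset_def)
  from linear_code_add[OF linear_code_dual this assms(1)] show ?thesis by simp
qed

lemma card_coset: "card (coset y) = card D"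
proof -
  have "bij_betw (\<lambda>z i. z i - y i) (coset y) D"
    by (rule bij_betw_byWitness[of _ "\<lambda>x i. x i + y i"]) (auto simp: coset_def)
  then show ?thesis by (rule bij_betw_same_card)
qed

lemma cosets_partition:
  "disjoint (coset ` dual_code n D)" "{} \<notin> coset ` dual_code n D"
  "\<Union>(coset ` dual_code n D) = dual_code n D"
proof -
  show "disjoint (coset ` dual_code n D)"
    unfolding disjoint_def using coset_eq by (metis disjoint_iff imageE)
  show "{} \<notin> coset ` dual_code n D" using coset_self by (metis empty_iff imageE)
  show "\<Union>(coset ` dual_code n D) = dual_code n D" using coset_self coset_dual by blast
qed

lemma card_cosets: "card (coset ` dual_code n D) * card D = card (dual_code n D)"
proof -
  have "card (\<Union>(coset ` dual_code n D)) = (\<Sum>X\<in>coset ` dual_code n D. card X)"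
  proof (rule card_Union_disjoint)
    show "pairwise disjnt (coset ` dual_code n D)"
      using cosets_partition(1) unfolding disjoint_def pairwise_def disjnt_def by blast
    fix X assume "X \<in> coset ` dual_code n D"
    then have "X \<subseteq> dual_code n D" using coset_dual by blast
    then show "finite X" using linear_code_finite[OF linear_code_dual] finite_subset by blast
  qed
  also have "\<dots> = (\<Sum>X\<in>coset ` dual_code n D. card D)"
    by (intro sum.cong refl) (auto simp: card_coset)
  finally show ?thesis unfolding cosets_partition(3) by simp
qed

lemma fixed_space_css_cosets:
  "fixed_space n (css_stabilizer n D) =
    {v. (\<forall>y. y \<notin> \<Union>(coset ` dual_code n D) \<longrightarrow> v y = 0)
      \<and> (\<forall>X\<in>coset ` dual_code n D. \<forall>x\<in>X. \<forall>y\<in>X. v x = v y)}"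
  unfolding fixed_space_css cosets_partition(3)
proof (rule Collect_cong, rule conj_cong[OF refl])
  fix v :: "(nat \<Rightarrow> 'a) \<Rightarrow> complex"
  assume supp: "\<forall>y. y \<notin> dual_code n D \<longrightarrow> v y = 0"
  show "(\<forall>a\<in>D. \<forall>y. v (\<lambda>i. y i - a i) = v y) \<longleftrightarrow> (\<forall>X\<in>coset ` dual_code n D. \<forall>x\<in>X. \<forall>y\<in>X. v x = v y)"
  proof (intro iffI ballI allI)
    fix X x y assume inv: "\<forall>a\<in>D. \<forall>y. v (\<lambda>i. y i - a i) = v y"
      and X: "X \<in> coset ` dual_code n D" "x \<in> X" "y \<in> X"
    then have "coset x = X" using coset_eq by blast
    then have "(\<lambda>i. y i - x i) \<in> D" using X(3) by (auto simp: coset_def)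
    from bspec[OF inv this, THEN spec, of y] show "v x = v y" by simp
  next
    fix a y assume const: "\<forall>X\<in>coset ` dual_code n D. \<forall>x\<in>X. \<forall>y\<in>X. v x = v y" and a: "a \<in> D"
    let ?z = "\<lambda>i. y i - a i"
    have yz: "y \<in> coset ?z" using a by (simp add: coset_def)
    show "v ?z = v y"
    proof (cases "?z \<in> dual_code n D")
      case True
      then show ?thesis using const yz coset_self by blast
    next
      case False
      then have "y \<notin> dual_code n D"
        using coset_dual coset_eq[OF yz] coset_self by metis
      then show ?thesis using supp False by simp
    qed
  qed
qed

lemma cdim_css: "cdim (fixed_space n (css_stabilizer n D)) * card D = card (dual_code n D)"
proof -
  have "finite (coset ` dual_code n D)" using linear_code_finite[OF linear_code_dual] by blast
  then show ?thesis
    unfolding fixed_space_css_cosets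
    using cdim_partition_constant[OF _ cosets_partition(1,2)] card_cosets by simp
qed

end

section \<open>Roots, multiples and cyclotomic cosets\<close>

text \<open>The BCH bound without determinants: \<open>P\<close> vanishes at all support positions
  except \<open>i0\<close> and has degree below \<open>t\<close>. The weighted sum of its values is
  a combination of vanishing moments, yet only the term at \<open>i0\<close> survives.\<close>

lemma vanishing_moments_imp_zero:
  fixes c X :: "nat \<Rightarrow> 'b::field"
  assumes inj: "inj_on X {..<n}" and nz: "\<And>i. i < n \<Longrightarrow> X i \<noteq> 0"
    and van: "\<And>s. s < t \<Longrightarrow> (\<Sum>i<n. c i * X i ^ (b + s)) = 0"
    and w: "hweight n c \<le> t" and i0: "i0 < n"
  shows "c i0 = 0"
proof (rule ccontr)
  assume c0: "c i0 \<noteq> 0"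
  define I where "I = {i. i < n \<and> c i \<noteq> 0}"
  define P where "P = (\<Prod>i\<in>I - {i0}. [:- X i, 1:])"
  have finI: "finite I" by (simp add: I_def)
  have i0I: "i0 \<in> I" using i0 c0 by (simp add: I_def)
  have "degree P \<le> (\<Sum>i\<in>I - {i0}. degree [:- X i, 1:])" unfolding P_def
    by (rule degree_prod_sum_le[unfolded o_def]) (use finI in auto)
  also have "\<dots> = card I - 1" using finI i0I by simp
  also have "\<dots> < t"
  proof -
    have "card I \<le> t" using w by (simp add: hweight_def I_def)
    moreover have "card I > 0" using finI i0I by (auto simp: card_gt_0_iff)
    ultimately show ?thesis by simp
  qed
  finally have deg: "degree P < t" .
  have "(\<Sum>i<n. c i * X i ^ b * poly P (X i)) = (\<Sum>i<n. \<Sum>s\<le>degree P. coeff P s * (c i * X i ^ (b + s)))"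
    by (simp add: poly_altdef sum_distrib_left power_add mult_ac)
  also have "\<dots> = (\<Sum>s\<le>degree P. coeff P s * (\<Sum>i<n. c i * X i ^ (b + s)))"
    by (subst sum.swap) (simp add: sum_distrib_left)
  also have "\<dots> = 0" using van deg by (intro sum.neutral) auto
  finally have "0 = (\<Sum>i<n. c i * X i ^ b * poly P (X i))" by simp
  also have "\<dots> = (\<Sum>i\<in>{i0}. c i * X i ^ b * poly P (X i))"
  proof (rule sum.mono_neutral_right)
    show "\<forall>i\<in>{..<n} - {i0}. c i * X i ^ b * poly P (X i) = 0"
    proof
      fix i assume i: "i \<in> {..<n} - {i0}"
      show "c i * X i ^ b * poly P (X i) = 0"
      proof (cases "c i = 0")
        case False
        then have "i \<in> I - {i0}" using i by (simp add: I_def)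
        then have "poly P (X i) = 0" unfolding P_def poly_prod using finI by (intro prod_zero) auto
        then show ?thesis by simp
      qed simp
    qed
  qed (use i0 in auto)
  also have "\<dots> = c i0 * X i0 ^ b * poly P (X i0)" by simp
  finally have "poly P (X i0) = 0" using c0 nz[OF i0] by simp
  then obtain i where "i \<in> I - {i0}" "X i0 = X i"
    unfolding P_def poly_prod using finI by (auto simp: prod_zero_iff)
  then show False using inj i0 unfolding inj_on_def I_def by auto
qed

text \<open>Roots are split off one by one; injectivity ensures that the quotient still vanishes at
  the remaining ones.\<close>

lemma prod_linear_dvd_iff:
  fixes f :: "'i \<Rightarrow> 'b::field"
  assumes "finite A" "inj_on f A"
  shows "(\<Prod>z\<in>A. [:- f z, 1:]) dvd p \<longleftrightarrow> (\<forall>z\<in>A. poly p (f z) = 0)"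
  using assms
proof (induction A arbitrary: p rule: finite_induct)
  case (insert z A)
  show ?case
  proof
    assume *: "(\<Prod>z\<in>insert z A. [:- f z, 1:]) dvd p"
    show "\<forall>w\<in>insert z A. poly p (f w) = 0"
    proof
      fix w assume "w \<in> insert z A"
      then have "[:- f w, 1:] dvd (\<Prod>z\<in>insert z A. [:- f z, 1:])"
        using insert.hyps by (intro dvd_prodI) auto
      then show "poly p (f w) = 0" using * dvd_trans poly_eq_0_iff_dvd by blast
    qed
  next
    assume *: "\<forall>w\<in>insert z A. poly p (f w) = 0"
    then obtain r where r: "p = [:- f z, 1:] * r" using poly_eq_0_iff_dvd by (metis dvdE insertI1)
    have "poly r (f w) = 0" if "w \<in> A" for w
    proof -
      have "f w \<noteq> f z" using insert.prems insert.hyps that by (auto simp: inj_on_def)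
      then show ?thesis using * that r by auto
    qed
    then have "(\<Prod>z\<in>A. [:- f z, 1:]) dvd r" using insert.IH insert.prems by (simp add: inj_on_def)
    then show "(\<Prod>z\<in>insert z A. [:- f z, 1:]) dvd p"
      unfolding r prod.insert[OF insert.hyps] by (intro mult_dvd_mono dvd_refl)
  qed
qed simp

lemma card_not_multiples:
  assumes "q > 0"
  shows "card {z \<in> {1..N}. \<not> q dvd z} = N - N div q"
proof -
  have *: "{z \<in> {1..N}. q dvd z} = (\<lambda>k. q * k) ` {1..N div q}"
  proof (intro equalityI subsetI)
    fix z assume "z \<in> {z \<in> {1..N}. q dvd z}"
    then obtain k where k: "z = q * k" "1 \<le> z" "z \<le> N" by auto
    then have "k \<le> N div q" using assms by (simp add: less_eq_div_iff_mult_less_eq mult.commute)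
    moreover have "1 \<le> k" using k by (cases k) auto
    ultimately show "z \<in> (\<lambda>k. q * k) ` {1..N div q}" using k(1) by (intro image_eqI[of _ _ k]) auto
  next
    fix z assume "z \<in> (\<lambda>k. q * k) ` {1..N div q}"
    then obtain k where k: "z = q * k" "1 \<le> k" "k \<le> N div q" by (metis atLeastAtMost_iff imageE)
    then have "k * q \<le> N" using assms by (simp add: less_eq_div_iff_mult_less_eq)
    then show "z \<in> {z \<in> {1..N}. q dvd z}"
      using k assms by (simp add: mult.commute)
  qed
  have "card {z \<in> {1..N}. q dvd z} = N div q"
    unfolding * using assms by (subst card_image) (auto simp: inj_on_def)
  moreover have "{z \<in> {1..N}. \<not> q dvd z} = {1..N} - {z \<in> {1..N}. q dvd z}" by blast
  moreover have "card ({1..N} - {z \<in> {1..N}. q dvd z}) = card {1..N} - card {z \<in> {1..N}. q dvd z}"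
    by (rule card_Diff_subset) auto
  ultimately show ?thesis by simp
qed

text \<open>Links the real expression in the code dimension to the count in
  \<open>card_not_multiples\<close>.\<close>

lemma ceiling_card_formula:
  assumes "q > 0"
  shows "\<lceil>real N * (1 - 1 / real q)\<rceil> = int (N - N div q)"
proof -
  have "real N * (1 - 1 / real q) = of_int (int N) - real N / real q"
    by (simp add: algebra_simps)
  then have "\<lceil>real N * (1 - 1 / real q)\<rceil> = int N - \<lfloor>real N / real q\<rfloor>"
    by (simp add: ceiling_def) linarith
  also have "\<dots> = int (N - N div q)" by (simp add: floor_divide_of_nat_eq of_nat_diff)
  finally show ?thesis .
qed

lemma factor_out_power:
  fixes q x :: nat
  assumes "q \<ge> 2" "x > 0"
  shows "\<exists>r e. x = r * q ^ e \<and> \<not> q dvd r"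
  using assms(2)
proof (induction x rule: less_induct)
  case (less x)
  show ?case
  proof (cases "q dvd x")
    case True
    then obtain y where y: "x = q * y" by blast
    then have "y < x" "y > 0" using less.prems assms by auto
    then obtain r e where "y = r * q ^ e" "\<not> q dvd r" using less.IH by blast
    then show ?thesis using y by (intro exI[of _ r] exI[of _ "Suc e"]) (simp add: mult_ac)
  next
    case False
    then show ?thesis by (intro exI[of _ x] exI[of _ 0]) simp
  qed
qed

section \<open>Arithmetic of cyclotomic cosets modulo \<open>q ^ m - 1\<close>\<close>

context
  fixes q m B :: nat
  assumes q2: "q \<ge> 2" and bound: "B * (q ^ (m div 2) + 1) < q ^ m - 1"
begin

text \<open>Multiplying by \<open>q ^ (m - j)\<close> swaps the roles of the two exponents modulo \<open>q ^ m - 1\<close>,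
  so one may assume that the exponent of \<open>q\<close> is at most \<open>m div 2\<close>.\<close>

lemma mult_power_le:
  assumes "z \<le> B" "j \<le> m div 2"
  shows "z * q ^ j \<le> B * q ^ (m div 2)"
  using assms q2 by (intro mult_mono power_increasing) auto

text \<open>For small \<open>j\<close> the number lies strictly between 0 and the modulus. In terms
  of cosets: the negatives of the coset of \<open>z\<close> avoid \<open>0, ..., B\<close>.\<close>

lemma not_dvd_mult_power_add:
  assumes z: "0 < z" "z \<le> B" and y: "y \<le> B" and j: "j < m"
  shows "\<not> (q ^ m - 1) dvd z * q ^ j + y"
proof (cases "j \<le> m div 2")
  case True
  have "z * q ^ j + y < q ^ m - 1" using mult_power_le[OF z(2) True] y bound by simp
  moreover have "0 < z * q ^ j + y" using z q2 by simp
  ultimately show ?thesis by (simp add: nat_dvd_not_less)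
next
  case False
  define n where "n = q ^ m - 1"
  have n: "q ^ m = n + 1" using q2 by (simp add: n_def)
  have le: "m - j \<le> m div 2" using False by linarith
  have "z + y * q ^ (m - j) < n" using mult_power_le[OF y le] z bound by (simp add: n_def)
  then have nd: "\<not> n dvd z + y * q ^ (m - j)" using z by (simp add: nat_dvd_not_less)
  have "q ^ j * q ^ (m - j) = n + 1" using j n by (simp flip: power_add)
  then have "(z * q ^ j + y) * q ^ (m - j) = z * n + (z + y * q ^ (m - j))"
    by (simp add: algebra_simps)
  then show ?thesis using nd by (metis dvd_add_right_iff dvd_mult2 dvd_triv_right n_def)
qed

text \<open>For small \<open>j\<close> both numbers are below the modulus, so the congruence is an
  equality, and \<open>q\<close> not dividing \<open>y\<close> forces \<open>j = 0\<close>. For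
  large \<open>j\<close> the swapped congruence would make \<open>q\<close> divide \<open>z\<close>.
  Hence different \<open>z\<close> have disjoint cosets, each of full size \<open>m\<close>.\<close>

lemma dvd_mult_power_diff:
  assumes z: "z \<le> B" "\<not> q dvd z" and y: "y \<le> B" "\<not> q dvd y" and j: "j < m"
    and dvd: "int (q ^ m - 1) dvd int z * int q ^ j - int y"
  shows "z = y \<and> j = 0"
proof -
  define n where "n = q ^ m - 1"
  have n: "q ^ m = n + 1" using q2 by (simp add: n_def)
  have eq: "u * q ^ k = v" if "u \<le> B" "v \<le> B" "k \<le> m div 2" "int n dvd int u * int q ^ k - int v" for u v k
  proof -
    have "u * q ^ k < n" "v < n" using mult_power_le[OF that(1,3)] that(2) bound by (auto simp: n_def)
    then have "int u * int q ^ k < int n" "int v < int n" "0 \<le> int u * int q ^ k"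
      by (metis of_nat_less_iff of_nat_mult of_nat_power, simp_all)
    then have "\<bar>int u * int q ^ k - int v\<bar> < int n" by linarith
    then have "int u * int q ^ k - int v = 0" using dvd_imp_le_int[OF _ that(4)] by linarith
    then have "int (u * q ^ k) = int v" by simp
    then show ?thesis by (simp only: of_nat_eq_iff)
  qed
  show ?thesis
  proof (cases "j \<le> m div 2")
    case True
    then have "z * q ^ j = y" using eq z y dvd by (simp add: n_def)
    then show ?thesis using y(2) by (cases j) auto
  next
    case False
    then have le: "m - j \<le> m div 2" by linarith
    have "int q ^ j * int q ^ (m - j) = int n + 1" 
    proof -
      have "int q ^ j * int q ^ (m - j) = int (q ^ m)" using j by (simp flip: power_add)
      then show ?thesis by (simp add: n)
    qed
    then have "(int z * int q ^ j - int y) * int q ^ (m - j)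
        = int z * int n - (int y * int q ^ (m - j) - int z)"
      by (simp add: algebra_simps)
    then have "int n dvd int z * int n - (int y * int q ^ (m - j) - int z)"
      using dvd unfolding n_def by (metis dvd_mult2)
    then have "int n dvd int y * int q ^ (m - j) - int z"
      by (metis dvd_diff_right_iff dvd_triv_right)
    then have "y * q ^ (m - j) = z" using eq z y le by blast
    then have "q dvd z" using j by (metis dvd_mult dvd_power zero_less_diff)
    then show ?thesis using z by simp
  qed
qed

end

section \<open>BCH codes\<close>

text \<open>\<open>B\<close> stands for \<delta>_max - 1; its explicit formula enters only through
  \<open>bound\<close> and \<open>\<delta>_le\<close>, so the parity of \<open>m\<close> is
  irrelevant here.\<close>

locale bch =
  fixes q m B \<delta> :: nat
    and \<phi> :: "'a::{finite,field} \<Rightarrow> 'b::{finite,field}"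
    and \<alpha> :: 'b
  assumes card_a: "CARD('a) = q" and card_b: "CARD('b) = q ^ m"
    and \<phi>_add: "\<And>x y. \<phi> (x + y) = \<phi> x + \<phi> y"
    and \<phi>_mult: "\<And>x y. \<phi> (x * y) = \<phi> x * \<phi> y" and \<phi>_1: "\<phi> 1 = 1"
    and \<alpha>_primitive: "\<And>k. 0 < k \<Longrightarrow> k < q ^ m - 1 \<Longrightarrow> \<alpha> ^ k \<noteq> 1" and \<alpha>_nz: "\<alpha> \<noteq> 0"
    and m_pos: "m > 0" and bound: "B * (q ^ (m div 2) + 1) < q ^ m - 1" and \<delta>_le: "\<delta> \<le> B + 1"
begin

definition n :: nat where "n = q ^ m - 1"

lemma q2: "q \<ge> 2"
proof -
  have "card {0, 1 :: 'a} \<le> CARD('a)" by (intro card_mono) auto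
  then show ?thesis by (simp add: card_a)
qed

lemma n_pos: "n > 0" using bound by (simp add: n_def)

lemma B_less_n: "B < n"
proof -
  have "B * 1 \<le> B * (q ^ (m div 2) + 1)" by (intro mult_le_mono2) simp
  then show ?thesis using bound by (simp add: n_def)
qed

lemma qm_eq: "q ^ m = Suc n" using q2 by (simp add: n_def)

text \<open>\<open>q\<close> divides a power of the prime characteristic of the large field. This
  makes raising to the power \<open>q\<close> additive there.\<close>

lemma q_char_power: "\<exists>s. q = CHAR('b) ^ s"
proof -
  obtain r where "q ^ m = CHAR('b) ^ r" using CARD_prime_power[where 'a='b] card_b by metis
  then have "q dvd CHAR('b) ^ r" using m_pos by (metis dvd_power)
  then show ?thesis using divides_primepow_nat[OF prime_CHAR_finite] by blast
qed

lemma \<phi>_0: "\<phi> 0 = 0" using \<phi>_add[of 0 0] by (metis add_0 add_cancel_right_right)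

lemma \<phi>_eq_0_iff: "\<phi> x = 0 \<longleftrightarrow> x = 0"
proof
  assume "\<phi> x = 0"
  show "x = 0"
  proof (rule ccontr)
    assume "x \<noteq> 0"
    then have "\<phi> x * \<phi> (1 / x) = 1" using \<phi>_mult[of x "1 / x"] \<phi>_1 by simp
    then show False using \<open>\<phi> x = 0\<close> by simp
  qed
qed (simp add: \<phi>_0)

lemma inj_\<phi>: "inj \<phi>"
proof (rule injI)
  fix x y assume "\<phi> x = \<phi> y"
  then have "\<phi> (x - y) = 0" using \<phi>_add[of "x - y" y] by simp
  then show "x = y" by (simp add: \<phi>_eq_0_iff)
qed

lemma \<phi>_power: "\<phi> (x ^ k) = \<phi> x ^ k"
  by (induction k) (auto simp: \<phi>_1 \<phi>_mult)

lemma \<phi>_fixed: "\<phi> x ^ q = \<phi> x"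
  using power_CARD_eq_self[of x] by (simp add: card_a flip: \<phi>_power)

lemma range_\<phi>: "{x. x ^ q = x} = range \<phi>"
  by (rule power_fixed_points_eq[OF q2]) (auto simp: card_image[OF inj_\<phi>] card_a \<phi>_fixed)

text \<open>The relative trace, pulled back along \<phi> so that its values lie in the small field;
  \<open>range_\<phi>\<close> shows that the inverse image exists.\<close>

definition Tr :: "'b \<Rightarrow> 'a" where
  "Tr x = inv \<phi> (pow_trace q m x)"

lemma \<phi>_Tr: "\<phi> (Tr x) = pow_trace q m x"
proof -
  obtain s where s: "q = CHAR('b) ^ s" using q_char_power by blast
  have "pow_trace q m x \<in> range \<phi>"
    using pow_trace_fixed[OF s card_b, of x] range_\<phi> by blast
  then show ?thesis unfolding Tr_def by (rule f_inv_into_f)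
qed

lemma Tr_add: "Tr (x + y) = Tr x + Tr y"
  by (rule injD[OF inj_\<phi>]) (metis \<phi>_Tr \<phi>_add pow_trace_add q_char_power)

lemma Tr_scale: "Tr (\<phi> c * x) = c * Tr x"
  by (rule injD[OF inj_\<phi>]) (simp add: \<phi>_Tr \<phi>_mult pow_trace_scale \<phi>_fixed)

lemma Tr_0: "Tr 0 = 0"
  using Tr_scale[of 0 0] by (simp add: \<phi>_0)

lemma Tr_sum: "Tr (\<Sum>i\<in>A. f i) = (\<Sum>i\<in>A. Tr (f i))"
  by (induction A rule: infinite_finite_induct) (auto simp: Tr_0 Tr_add)

lemma Tr_nondegenerate:
  assumes "\<And>t. Tr (t * x) = 0" shows "x = 0"
proof (rule pow_trace_nondegenerate[OF card_b q2 m_pos])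
  show "pow_trace q m (t * x) = 0" for t using \<phi>_Tr[of "t * x"] assms[of t] by (simp add: \<phi>_0)
qed

section \<open>Powers of the primitive element and their orthogonality\<close>

lemma \<alpha>_power_n: "\<alpha> ^ n = 1"
  using power_CARD_eq_self[of \<alpha>] \<alpha>_nz by (simp add: card_b qm_eq)

lemma \<alpha>_power_mod: "\<alpha> ^ (k mod n) = \<alpha> ^ k"
proof -
  have "\<alpha> ^ k = \<alpha> ^ (k mod n + n * (k div n))" by simp
  also have "\<dots> = \<alpha> ^ (k mod n)" by (simp only: power_add power_mult \<alpha>_power_n) simp
  finally show ?thesis by simp
qed

lemma \<alpha>_power_eq_1_iff: "\<alpha> ^ k = 1 \<longleftrightarrow> n dvd k"
proof
  assume "\<alpha> ^ k = 1"
  then have "\<alpha> ^ (k mod n) = 1" by (simp add: \<alpha>_power_mod)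
  then have "k mod n = 0" using \<alpha>_primitive[of "k mod n"] n_pos by (fastforce simp: n_def)
  then show "n dvd k" by blast
next
  assume "n dvd k"
  then show "\<alpha> ^ k = 1" by (metis \<alpha>_power_n dvdE power_mult power_one)
qed

lemma inj_on_\<alpha>_power: "inj_on (\<lambda>i. \<alpha> ^ i) {..<n}"
proof (rule linorder_inj_onI)
  fix i j assume "i < j" "i \<in> {..<n}" "j \<in> {..<n}"
  then have ij: "0 < j - i" "j - i < n" "j = i + (j - i)" by auto
  have "\<alpha> ^ (j - i) \<noteq> 1" using ij \<alpha>_primitive by (simp add: n_def)
  moreover have "\<alpha> ^ j = \<alpha> ^ i * \<alpha> ^ (j - i)" using ij by (metis power_add)
  ultimately show "\<alpha> ^ i \<noteq> \<alpha> ^ j" using \<alpha>_nz by simp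
qed auto

lemma of_nat_n: "(of_nat n :: 'b) = - 1"
proof -
  obtain r where "r > 0" "q ^ m = CHAR('b) ^ r" using CARD_prime_power[where 'a='b] card_b by metis
  then have "(of_nat (q ^ m) :: 'b) = 0" by (simp add: of_nat_power)
  then show ?thesis unfolding qm_eq by (simp add: add_eq_0_iff)
qed

text \<open>A geometric sum; the value -1 is \<open>n\<close> in the characteristic of the
  field.\<close>

lemma sum_\<alpha>_powers: "(\<Sum>i<n. \<alpha> ^ (k * i)) = (if n dvd k then - 1 else 0)"
proof (cases "n dvd k")
  case True
  then have "\<alpha> ^ (k * i) = 1" for i by (simp add: \<alpha>_power_eq_1_iff)
  then show ?thesis using True by (simp add: of_nat_n)
next
  case False
  have "(\<alpha> ^ k - 1) * (\<Sum>i<n. (\<alpha> ^ k) ^ i) = (\<alpha> ^ k) ^ n - 1"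
    by (rule power_diff_1_eq[symmetric])
  also have "(\<alpha> ^ k) ^ n = 1" by (metis \<alpha>_power_n mult.commute power_mult power_one)
  finally show ?thesis using False \<alpha>_power_eq_1_iff by (simp add: power_mult)
qed

text \<open>One representative of each cyclotomic coset of \<open>1, ..., \<delta> - 1\<close>:
  stripping factors of \<open>q\<close> leads into \<open>R\<close>, and
  \<open>dvd_mult_power_diff\<close> keeps its elements in different cosets.\<close>

definition R :: "nat set" where
  "R = {z \<in> {1..\<delta> - 1}. \<not> q dvd z}"

lemma finite_R: "finite R" by (simp add: R_def)

lemma R_bounds: "z \<in> R \<Longrightarrow> 0 < z \<and> z \<le> B \<and> \<not> q dvd z"
  using \<delta>_le by (auto simp: R_def)

text \<open>Delsarte's description of the dual of the BCH code as a trace code.\<close>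
definition trace_word :: "(nat \<Rightarrow> 'b) \<Rightarrow> nat \<Rightarrow> 'a" where
  "trace_word l i = (if i < n then Tr (\<Sum>z\<in>R. l z * \<alpha> ^ (z * i)) else 0)"

definition D :: "(nat \<Rightarrow> 'a) set" where
  "D = range trace_word"

text \<open>The value of the word polynomial at \<open>\<alpha> ^ k\<close>, that is, the discrete
  Fourier transform of the word.\<close>

definition ev :: "(nat \<Rightarrow> 'a) \<Rightarrow> nat \<Rightarrow> 'b" where
  "ev c k = (\<Sum>i<n. \<phi> (c i) * \<alpha> ^ (k * i))"

lemma linear_D: "linear_code n D"
  unfolding linear_code_def
proof (intro conjI ballI allI)
  show "D \<subseteq> vecs n" by (auto simp: D_def vecs_def trace_word_def)
  have "trace_word (\<lambda>_. 0) = (\<lambda>_. 0)" by (simp add: fun_eq_iff trace_word_def Tr_0)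
  then show "(\<lambda>_. 0) \<in> D" unfolding D_def by (metis rangeI)
next
  fix x y assume "x \<in> D" "y \<in> D"
  then obtain l k where "x = trace_word l" "y = trace_word k" unfolding D_def by blast
  then have "(\<lambda>i. x i + y i) = trace_word (\<lambda>z. l z + k z)"
    by (simp add: fun_eq_iff trace_word_def distrib_right sum.distrib Tr_add)
  then show "(\<lambda>i. x i + y i) \<in> D" unfolding D_def by blast
next
  fix c x assume "x \<in> D"
  then obtain l where "x = trace_word l" unfolding D_def by blast
  then have "(\<lambda>i. c * x i) = trace_word (\<lambda>z. \<phi> c * l z)"
    by (simp add: fun_eq_iff trace_word_def mult.assoc Tr_scale flip: sum_distrib_left)
  then show "(\<lambda>i. c * x i) \<in> D" unfolding D_def by blast
qed

lemma \<phi>_trace_word: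
  assumes "i < n"
  shows "\<phi> (trace_word l i) = (\<Sum>z\<in>R. \<Sum>j<m. l z ^ (q ^ j) * \<alpha> ^ (z * q ^ j * i))"
proof -
  obtain s where s: "q = CHAR('b) ^ s" using q_char_power by blast
  have "\<phi> (trace_word l i) = (\<Sum>z\<in>R. pow_trace q m (l z * \<alpha> ^ (z * i)))"
    using assms by (simp add: trace_word_def \<phi>_Tr pow_trace_sum[OF s])
  moreover have "pow_trace q m (l z * \<alpha> ^ (z * i)) = (\<Sum>j<m. l z ^ (q ^ j) * \<alpha> ^ (z * q ^ j * i))" for z
  proof -
    have "z * i * q ^ j = z * q ^ j * i" for j by simp
    then show ?thesis unfolding pow_trace_def by (simp only: power_mult_distrib flip: power_mult)
  qed
  ultimately show ?thesis by simp
qed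

text \<open>Expanding the trace writes the word as a combination of powers with exponents
  \<open>z * q ^ j\<close>; orthogonality selects those cancelling \<open>y\<close> modulo
  \<open>n\<close>.\<close>

lemma ev_trace_word:
  "ev (trace_word l) y = (\<Sum>z\<in>R. \<Sum>j<m. if n dvd z * q ^ j + y then - (l z ^ (q ^ j)) else 0)"
proof -
  have "ev (trace_word l) y = (\<Sum>i<n. \<Sum>z\<in>R. \<Sum>j<m. l z ^ (q ^ j) * \<alpha> ^ ((z * q ^ j + y) * i))"
    unfolding ev_def
  proof (rule sum.cong[OF refl])
    fix i assume "i \<in> {..<n}"
    then show "\<phi> (trace_word l i) * \<alpha> ^ (y * i) = (\<Sum>z\<in>R. \<Sum>j<m. l z ^ (q ^ j) * \<alpha> ^ ((z * q ^ j + y) * i))"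
      by (simp add: \<phi>_trace_word sum_distrib_right distrib_right power_add mult.assoc)
  qed
  also have "\<dots> = (\<Sum>z\<in>R. \<Sum>j<m. \<Sum>i<n. l z ^ (q ^ j) * \<alpha> ^ ((z * q ^ j + y) * i))"
    by (subst sum.swap) (intro sum.cong refl sum.swap)
  also have "\<dots> = (\<Sum>z\<in>R. \<Sum>j<m. if n dvd z * q ^ j + y then - (l z ^ (q ^ j)) else 0)"
    by (intro sum.cong refl) (simp add: sum_\<alpha>_powers flip: sum_distrib_left)
  finally show ?thesis .
qed

text \<open>The \<open>B + 1\<close> consecutive zeros, exponent 0 included, give both
  self-orthogonality of \<open>D\<close> and the weight bound for its words.\<close>

lemma ev_D_eq_0:
  assumes "x \<in> D" "y \<le> B" shows "ev x y = 0"
proof -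
  obtain l where l: "x = trace_word l" using assms unfolding D_def by blast
  have "\<not> n dvd z * q ^ j + y" if "z \<in> R" "j < m" for z j
    using not_dvd_mult_power_add[OF q2 bound _ _ assms(2) that(2)] R_bounds[OF that(1)] by (simp add: n_def)
  then show ?thesis unfolding l ev_trace_word by (intro sum.neutral ballI) auto
qed

text \<open>At the exponent \<open>n - w\<close>, which represents \<open>-w\<close>, only the term
  with \<open>z = w\<close> and \<open>j = 0\<close> remains, so the coefficients can be read off
  the word.\<close>

lemma ev_trace_word_recover:
  assumes w: "w \<in> R" shows "ev (trace_word l) (n - w) = - l w"
proof -
  have wn: "w \<le> n" using R_bounds[OF w] B_less_n by simp
  have iff: "n dvd z * q ^ j + (n - w) \<longleftrightarrow> z = w \<and> j = 0" if z: "z \<in> R" and j: "j < m" for z j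
  proof
    assume "n dvd z * q ^ j + (n - w)"
    \<comment> \<open>Passing to integers removes the truncated subtraction, so that
      \<open>n\<close> can be cancelled.\<close>
    then have "int n dvd int (z * q ^ j + (n - w))" by (simp only: of_nat_dvd_iff)
    also have "int (z * q ^ j + (n - w)) = int n + (int z * int q ^ j - int w)"
      using wn by (simp add: of_nat_diff)
    finally have "int n dvd int z * int q ^ j - int w" by simp
    then show "z = w \<and> j = 0"
      using dvd_mult_power_diff[OF q2 bound, of z w j] R_bounds[OF z] R_bounds[OF w] j by (simp add: n_def)
  qed (use wn in auto)
  have "ev (trace_word l) (n - w) = (\<Sum>z\<in>R. \<Sum>j<m. if z = w \<and> j = 0 then - l w else 0)"
    unfolding ev_trace_word by (intro sum.cong refl) (auto simp: iff)
  also have "\<dots> = (\<Sum>z\<in>R. if z = w then - l w else 0)"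
  proof (intro sum.cong refl)
    fix z
    show "(\<Sum>j<m. if z = w \<and> j = 0 then - l w else 0) = (if z = w then - l w else 0)"
      using m_pos by (cases "z = w") auto
  qed
  also have "\<dots> = - l w" using w finite_R by simp
  finally show ?thesis .
qed

text \<open>Coefficients outside \<open>R\<close> do not affect the word; restricting to extensional
  functions on \<open>R\<close> makes \<open>trace_word\<close> injective.\<close>

lemma card_D: "card D = q ^ (m * card R)"
proof -
  have "D = trace_word ` (PiE R (\<lambda>_. UNIV))"
  proof (intro equalityI subsetI)
    fix x assume "x \<in> D"
    then obtain l where l: "x = trace_word l" unfolding D_def by blast
    have "trace_word l = trace_word (restrict l R)" by (simp add: fun_eq_iff trace_word_def)
    then show "x \<in> trace_word ` (PiE R (\<lambda>_. UNIV))" using l by (intro image_eqI[of _ _ "restrict l R"]) auto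
  qed (auto simp: D_def)
  moreover have "inj_on trace_word (PiE R (\<lambda>_. UNIV))"
  proof (rule inj_onI)
    fix l k assume lk: "l \<in> PiE R (\<lambda>_. UNIV)" "k \<in> PiE R (\<lambda>_. UNIV)" and eq: "trace_word l = trace_word k"
    show "l = k"
    proof (rule PiE_ext[OF lk])
      fix z assume "z \<in> R"
      then show "l z = k z" using ev_trace_word_recover[of z l] ev_trace_word_recover[of z k] eq by simp
    qed
  qed
  ultimately show ?thesis using finite_R by (simp add: card_image card_PiE card_b flip: power_mult)
qed

lemma dotp_trace_word:
  "dotp n (trace_word l) c = (\<Sum>z\<in>R. Tr (l z * ev c z))"
proof -
  have "dotp n (trace_word l) c = (\<Sum>i<n. \<Sum>z\<in>R. Tr (l z * (\<phi> (c i) * \<alpha> ^ (z * i))))"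
    unfolding dotp_def
  proof (rule sum.cong[OF refl])
    fix i assume "i \<in> {..<n}"
    then have "trace_word l i * c i = Tr (\<phi> (c i) * (\<Sum>z\<in>R. l z * \<alpha> ^ (z * i)))"
      by (simp add: trace_word_def Tr_scale mult.commute)
    then show "trace_word l i * c i = (\<Sum>z\<in>R. Tr (l z * (\<phi> (c i) * \<alpha> ^ (z * i))))"
      by (simp add: sum_distrib_left Tr_sum mult.left_commute)
  qed
  also have "\<dots> = (\<Sum>z\<in>R. Tr (l z * ev c z))"
    by (subst sum.swap) (simp add: ev_def sum_distrib_left Tr_sum)
  finally show ?thesis .
qed

text \<open>Coefficient functions concentrated at a single \<open>w\<close> separate the conditions,
  and nondegeneracy of the trace turns each into a zero of \<open>ev c\<close>.\<close>

lemma dual_D_iff: "c \<in> dual_code n D \<longleftrightarrow> c \<in> vecs n \<and> (\<forall>z\<in>R. ev c z = 0)"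
proof
  assume c: "c \<in> dual_code n D"
  have "ev c w = 0" if w: "w \<in> R" for w
  proof (rule Tr_nondegenerate)
    fix t
    have "0 = dotp n (trace_word (\<lambda>z. if z = w then t else 0)) c"
      using c unfolding dual_code_def D_def by auto
    also have "\<dots> = (\<Sum>z\<in>R. if z = w then Tr (t * ev c w) else 0)"
      unfolding dotp_trace_word by (intro sum.cong refl) (auto simp: Tr_0)
    also have "\<dots> = Tr (t * ev c w)" using w finite_R by simp
    finally show "Tr (t * ev c w) = 0" by simp
  qed
  then show "c \<in> vecs n \<and> (\<forall>z\<in>R. ev c z = 0)" using c by (simp add: dual_code_def)
next
  assume "c \<in> vecs n \<and> (\<forall>z\<in>R. ev c z = 0)"
  then show "c \<in> dual_code n D" by (auto simp: dual_code_def D_def dotp_trace_word Tr_0)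
qed

lemma D_subset_dual: "D \<subseteq> dual_code n D"
proof
  fix x assume x: "x \<in> D"
  then show "x \<in> dual_code n D"
    using linear_code_subset[OF linear_D] ev_D_eq_0[OF x] R_bounds unfolding dual_D_iff by blast
qed

sublocale self_orthogonal_code n D
  by unfold_locales (fact linear_D, fact D_subset_dual)

text \<open>The entries of \<open>c\<close> come from the small field and are fixed by the power
  \<open>q\<close>, so zeros propagate along cyclotomic cosets.\<close>

lemma ev_mult_power: "ev c (k * q ^ j) = ev c k ^ (q ^ j)"
proof -
  obtain s where s: "q = CHAR('b) ^ s" using q_char_power by blast
  have "ev c k ^ (q ^ j) = (\<Sum>i<n. (\<phi> (c i) * \<alpha> ^ (k * i)) ^ (q ^ j))"
    unfolding ev_def by (rule char_power_sum[OF s])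
  also have "\<dots> = ev c (k * q ^ j)" unfolding ev_def
  proof (intro sum.cong refl)
    fix i
    have "k * i * q ^ j = k * q ^ j * i" by simp
    then show "(\<phi> (c i) * \<alpha> ^ (k * i)) ^ (q ^ j) = \<phi> (c i) * \<alpha> ^ (k * q ^ j * i)"
      by (simp only: power_mult_distrib power_fixed_iterate[OF \<phi>_fixed] flip: power_mult)
  qed
  finally show ?thesis by simp
qed

lemma ev_mod: "ev c (k mod n) = ev c k"
  unfolding ev_def power_mult \<alpha>_power_mod by simp

lemma ev_zero_of_R:
  assumes "\<forall>z\<in>R. ev c z = 0" "x \<in> {1..<\<delta>}"
  shows "ev c x = 0"
proof -
  obtain r e where re: "x = r * q ^ e" "\<not> q dvd r" using factor_out_power[OF q2, of x] assms(2) by auto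
  have "r \<le> x" using re q2 by simp
  moreover have "r > 0" using re by (cases r) auto
  ultimately have "r \<in> R" using assms(2) re(2) by (simp add: R_def)
  then show ?thesis using assms(1) q2 re ev_mult_power[of c r e] by (simp add: power_0_left)
qed

lemma ev_zeros_iff: "(\<forall>z\<in>bch_zeros q n \<delta>. ev c z = 0) \<longleftrightarrow> (\<forall>z\<in>R. ev c z = 0)"
proof
  assume *: "\<forall>z\<in>bch_zeros q n \<delta>. ev c z = 0"
  show "\<forall>z\<in>R. ev c z = 0"
  proof
    fix z assume z: "z \<in> R"
    have "z * q ^ 0 mod n \<in> bch_zeros q n \<delta>"
      using z unfolding bch_zeros_def cyc_coset_def R_def by fastforce
    then show "ev c z = 0" using * ev_mod[of c z] by auto
  qed
next
  assume *: "\<forall>z\<in>R. ev c z = 0"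
  show "\<forall>z\<in>bch_zeros q n \<delta>. ev c z = 0"
  proof
    fix z assume "z \<in> bch_zeros q n \<delta>"
    then obtain x k where x: "x \<in> {1..<\<delta>}" "z = x * q ^ k mod n"
      unfolding bch_zeros_def cyc_coset_def by blast
    then show "ev c z = 0"
      using ev_zero_of_R[OF * x(1)] q2 by (simp add: ev_mod ev_mult_power power_0_left)
  qed
qed

text \<open>The exponents in \<open>bch_zeros\<close> are reduced modulo \<open>n\<close>, so the
  roots are distinct and divisibility by the generator means vanishing at each of them.\<close>

lemma bch_code_eq_dual: "bch_code q n \<phi> \<alpha> \<delta> = dual_code n D"
proof -
  have sub: "bch_zeros q n \<delta> \<subseteq> {..<n}"
    using n_pos by (auto simp: bch_zeros_def cyc_coset_def)
  then have fin: "finite (bch_zeros q n \<delta>)" using finite_subset by blast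
  have inj: "inj_on (\<lambda>z. \<alpha> ^ z) (bch_zeros q n \<delta>)" by (rule inj_on_subset[OF inj_on_\<alpha>_power sub])
  have "poly (\<Sum>i<n. monom (\<phi> (c i)) i) (\<alpha> ^ z) = ev c z" for c z
    by (simp add: poly_sum poly_monom ev_def power_mult)
  then have "bch_gen q n \<alpha> \<delta> dvd (\<Sum>i<n. monom (\<phi> (c i)) i) \<longleftrightarrow> (\<forall>z\<in>R. ev c z = 0)" for c
    unfolding bch_gen_def prod_linear_dvd_iff[OF fin inj] by (simp add: ev_zeros_iff)
  then show ?thesis unfolding bch_code_def by (auto simp: dual_D_iff)
qed

text \<open>The BCH bound with arbitrary first exponent: it is used with \<open>b = 0\<close> for
  \<open>D\<close> and with \<open>b = 1\<close> for the dual. The embedding preserves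
  weights.\<close>

lemma hweight_gt:
  assumes x: "x \<in> vecs n" "x \<noteq> (\<lambda>_. 0)" and van: "\<And>s. s < t \<Longrightarrow> ev x (b + s) = 0"
  shows "t < hweight n x"
proof (rule ccontr)
  assume "\<not> t < hweight n x"
  then have w: "hweight n (\<lambda>i. \<phi> (x i)) \<le> t" by (simp add: hweight_def \<phi>_eq_0_iff)
  have van': "(\<Sum>i<n. \<phi> (x i) * (\<alpha> ^ i) ^ (b + s)) = 0" if "s < t" for s
    using van[OF that] unfolding ev_def by (simp add: mult.commute flip: power_mult)
  have "x i = 0" for i
  proof (cases "i < n")
    case True
    have "\<phi> (x i) = 0"
      using vanishing_moments_imp_zero[OF inj_on_\<alpha>_power _ van' w True] \<alpha>_nz by simp
    then show ?thesis by (simp add: \<phi>_eq_0_iff)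
  next
    case False
    then show ?thesis using x by (simp add: vecs_def)
  qed
  then show False using x by (simp add: fun_eq_iff)
qed

lemma hweight_D:
  assumes "x \<in> D" "x \<noteq> (\<lambda>_. 0)" shows "B + 1 < hweight n x"
  using hweight_gt[OF D_vecs[OF assms(1)] assms(2), of "B + 1" 0] ev_D_eq_0[OF assms(1)] by simp

lemma hweight_dual:
  assumes "x \<in> dual_code n D" "x \<noteq> (\<lambda>_. 0)" shows "\<delta> \<le> hweight n x"
proof -
  have "ev x (1 + s) = 0" if "s < \<delta> - 1" for s
    using assms(1) that ev_zero_of_R[of x "1 + s"] unfolding dual_D_iff by auto
  then have "\<delta> - 1 < hweight n x" by (rule hweight_gt[OF dual_vecs[OF assms(1)] assms(2)])
  then show ?thesis by simp
qed

text \<open>The dimension is the index of \<open>D\<close> in its dual; multiplying by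
  \<open>card D\<close> twice gives \<open>q ^ n\<close> by \<open>cdim_css\<close> and
  \<open>card_dual_code\<close>.\<close>

lemma cdim_bch:
  "\<exists>k. int k = int n - 2 * int m * \<lceil>real (\<delta> - 1) * (1 - 1 / real q)\<rceil>
    \<and> cdim (fixed_space n (css_stabilizer n D)) = q ^ k"
proof -
  let ?r = "m * card R"
  let ?d = "cdim (fixed_space n (css_stabilizer n D))"
  have "card R = \<delta> - 1 - (\<delta> - 1) div q"
    unfolding R_def using q2 by (intro card_not_multiples) simp
  then have cR: "int (card R) = \<lceil>real (\<delta> - 1) * (1 - 1 / real q)\<rceil>"
    using ceiling_card_formula[of q "\<delta> - 1"] q2 by simp
  have e: "?d * q ^ (2 * ?r) = q ^ n"
  proof -
    have "?d * q ^ (2 * ?r) = (?d * card D) * card D"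
      by (simp add: card_D mult_2 power_add)
    also have "\<dots> = q ^ n"
      using cdim_css card_dual_code[OF linear_D] by (simp add: card_a mult.commute)
    finally show ?thesis .
  qed
  \<comment> \<open>Positivity of the dimension is what yields \<open>2 * ?r \<le> n\<close>, hence
    a natural exponent \<open>k\<close>.\<close>
  have "?d > 0" using e q2 by (intro gr0I) simp
  then have "q ^ (2 * ?r) \<le> q ^ n" using e by (metis One_nat_def Suc_leI mult_le_mono1 nat_mult_1)
  then have le: "2 * ?r \<le> n" using q2 by (simp add: power_increasing_iff)
  then have "?d * q ^ (2 * ?r) = q ^ (n - 2 * ?r) * q ^ (2 * ?r)" using e by (simp flip: power_add)
  then have "?d = q ^ (n - 2 * ?r)" using q2 by simp
  moreover have "int (n - 2 * ?r) = int n - 2 * int m * \<lceil>real (\<delta> - 1) * (1 - 1 / real q)\<rceil>"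
    using le unfolding cR[symmetric] by (simp add: of_nat_diff)
  ultimately show ?thesis by blast
qed

end

theorem mainTheorem10:
  fixes q m \<delta> :: nat
    and \<phi> :: "'a::{finite,field} \<Rightarrow> 'b::{finite,field}"
    and \<alpha> :: 'b
  assumes "CARD('a) = q"
    and "CARD('b) = q ^ m"
    and "\<And>x y. \<phi> (x + y) = \<phi> x + \<phi> y" and "\<And>x y. \<phi> (x * y) = \<phi> x * \<phi> y" and "\<phi> 1 = 1"
    and "\<And>k. 0 < k \<Longrightarrow> k < q ^ m - 1 \<Longrightarrow> \<alpha> ^ k \<noteq> 1" and "\<alpha> \<noteq> 0"
    and "m \<ge> 2"
    and "2 \<le> \<delta>"
    and "int \<delta> \<le> int q ^ ((m + 1) div 2) - 1 - (if odd m then int q - 2 else 0)"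
  shows "\<exists>S :: 'a qop set.
    abelian_pauli_subgroup (q ^ m - 1) S
    \<and> (\<exists>k. int k = int (q ^ m - 1) - 2 * int m * \<lceil>real (\<delta> - 1) * (1 - 1 / real q)\<rceil>
           \<and> cdim (fixed_space (q ^ m - 1) S) = q ^ k)
    \<and> qdist_ge (q ^ m - 1) S \<delta>
    \<and> pure_upto (q ^ m - 1) S (nat (int q ^ ((m + 1) div 2) - 1 - (if odd m then int q - 2 else 0)) + 1)
    \<and> (\<forall>d. classical_min_dist (q ^ m - 1) (bch_code q (q ^ m - 1) \<phi> \<alpha> \<delta>) d
           \<and> int d \<le> int q ^ ((m + 1) div 2) - 1 - (if odd m then int q - 2 else 0)
         \<longrightarrow> qmin_dist (q ^ m - 1) S d \<and> pure_upto (q ^ m - 1) S d)"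
proof -
  let ?M = "int q ^ ((m + 1) div 2) - 1 - (if odd m then int q - 2 else 0)"
  define B where "B = nat ?M - 1"
  have B: "int B = ?M - 1" using assms(9,10) by (simp add: B_def nat_diff_distrib)
  have q2: "q \<ge> 2"
  proof -
    have "card {0, 1 :: 'a} \<le> CARD('a)" by (intro card_mono) auto
    then show ?thesis using assms(1) by simp
  qed
  define h where "h = m div 2"
  define Q where "Q = int q ^ h"
  have Q: "Q \<ge> int q" using assms(8) q2 power_increasing[of 1 h "int q"] by (simp add: Q_def h_def)
  \<comment> \<open>For odd \<open>m\<close>, \<open>B = q * Q - q\<close> and the product is
    \<open>q ^ m - q\<close>; for even \<open>m\<close>, \<open>B = Q - 2\<close> and it is
    \<open>q ^ m - Q - 2\<close>.\<close>
  have "int B * (Q + 1) < int q ^ m - 1"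
  proof (cases "odd m")
    case True
    then have "m = Suc (h + h)" "(m + 1) div 2 = Suc h" by (auto simp: h_def elim!: oddE)
    then have "int B = int q * Q - int q" and qm: "int q ^ m = int q * Q * Q"
      using B True by (simp_all add: Q_def power_add)
    then have "int B * (Q + 1) = int q * Q * Q - int q" by (simp only:) (simp add: algebra_simps)
    then show ?thesis using q2 qm by simp
  next
    case False
    then have "m = h + h" "(m + 1) div 2 = h" by (auto simp: h_def elim!: evenE)
    then have "int B = Q - 2" and qm: "int q ^ m = Q * Q"
      using B False by (simp_all add: Q_def power_add)
    then have "int B * (Q + 1) = Q * Q - Q - 2" by (simp only:) (simp add: algebra_simps)
    then show ?thesis using q2 Q qm by simp
  qed
  then have "int (B * (q ^ (m div 2) + 1)) < int (q ^ m - 1)"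
    using q2 by (simp add: Q_def h_def of_nat_diff distrib_left)
  then have bound: "B * (q ^ (m div 2) + 1) < q ^ m - 1" by (simp only: of_nat_less_iff)
  have \<delta>: "\<delta> \<le> B + 1" using assms(10) B by linarith
  interpret bch q m B \<delta> \<phi> \<alpha>
    by unfold_locales (use assms bound \<delta> in auto)
  \<comment> \<open>Since \<open>hweight_D\<close> is strict, nonzero words of \<open>D\<close> have
    weight at least \<open>B + 2\<close>, which is \<delta>_max + 1.\<close>
  have t: "nat ?M + 1 = B + 2" using B by linarith
  show ?thesis
    unfolding n_def[symmetric]
  proof (intro exI[of _ "css_stabilizer n D"] conjI allI impI)
    show "abelian_pauli_subgroup n (css_stabilizer n D)" by (rule css_abelian)
    show "\<exists>k. int k = int n - 2 * int m * \<lceil>real (\<delta> - 1) * (1 - 1 / real q)\<rceil>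
      \<and> cdim (fixed_space n (css_stabilizer n D)) = q ^ k" by (rule cdim_bch)
    show "qdist_ge n (css_stabilizer n D) \<delta>" by (rule css_qdist_ge[OF hweight_dual])
    show "pure_upto n (css_stabilizer n D) (nat ?M + 1)"
      unfolding t using hweight_D by (intro css_pure_upto) (simp add: Suc_leI)
    fix d assume d: "classical_min_dist n (bch_code q n \<phi> \<alpha> \<delta>) d \<and> int d \<le> ?M"
    \<comment> \<open>Nonzero words of \<open>D\<close> are therefore heavier than \<open>d\<close>;
      this yields both the exact distance and purity up to \<open>d\<close>.\<close>
    then have dB: "d \<le> B + 1" using B by linarith
    show "qmin_dist n (css_stabilizer n D) d"
      using d hweight_D dB unfolding bch_code_eq_dual by (intro css_qmin_dist) fastforce+
    show "pure_upto n (css_stabilizer n D) d"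
      using hweight_D dB by (intro css_pure_upto) fastforce
  qed
qed

end
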